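(* Let $k\ge 1$ be an integer, and let $\alpha_j$ $(j\ge 0)$, $\beta_k,\beta_k^{(1)},\beta_k^{(2)}$, $D_k$ and the function $f_k$ be as defined in the context. 1. Let $\alpha$ be an irrational real number with $\alpha\not\sim\alpha_j$ for all $j$ with $0\le j\le k-1$. Then there exists an increasing (infinite) sequence of positive integers $q_n$ such that for every $n$ $$\lim_{t\to q_n-} t\cdot\psi_\alpha(t)\ \ge\ f_k(q_n).$$ 2. Let $\alpha=\beta_k$ if $k$ is odd, and let $\alpha$ be either of the numbers $\beta_k^{(1)}$, $\beta_k^{(2)}$ if $k$ is even. Then a) $t\,\psi_\alpha(t)<f_k(t)$ for all $t$ large enough; b) there exists an increasing (infinite) sequence of positive integers $q_n$ such that $\lim\limits_{t\to q_n-}\frac{t\,\psi_\alpha(t)}{f_k(t)}=1$ for every $n$.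
   Context: For an irrational real number $\alpha$ and real $t\ge 1$, $\psi_\alpha(t)=\min_{q\in\mathbb{Z},\,1\le q\le t}\|q\alpha\|$, where $\|\xi\|=\min_{a\in\mathbb{Z}}|\xi-a|$. The symbol $\lim_{t\to q-}$ denotes the left-hand limit at $q$ (so $q\ge2$ is understood). Continued fractions are regular: $[a_0;a_1,a_2,\ldots]$ with $a_0\in\mathbb{Z}$ and $a_j$ positive integers for $j\ge1$. Two irrationals $\alpha=[a_0;a_1,\ldots]$ and $\beta=[b_0;b_1,\ldots]$ are equivalent, written $\alpha\sim\beta$, if there exist $n_0,m_0$ such that $a_{n_0+s}=b_{m_0+s}$ for all $s=1,2,3,\ldots$. The notation $1_s$ stands for $s$ consecutive partial quotients equal to $1$ (none if $s=0$), and an overline denotes the (infinitely repeated) period. Define $\alpha_0=[\overline{1}]=\frac{1+\sqrt5}{2}$ and, for $k\ge1$, $\alpha_k=[\overline{1_{2k-1},2}]$, the purely periodic continued fraction (starting with its integer part) whose period is $2k-1$ ones followed by a $2$. For $k\ge 1$ let $$D_k=\frac{2\alpha_k+1}{2\alpha_k+2},$$ which equals $\limsup_{t\to\infty}t\,\psi_{\alpha_k}(t)$. Define $$\beta_k=[0;1_{k-1},\overline{2,1_{2k-1}}]\quad(k\ge 1),$$ and, for even $k$, $$\beta_k^{(1)}=[0;1_k,\overline{2,1_{2k-1}}],\qquad \beta_k^{(2)}=[0;1_{k-2},\overline{2,1_{2k-1}}].$$ Define $$f_k(x)=\frac{2D_k}{1+\sqrt{1-\frac{2\alpha_k}{(2\beta_k+1)(\alpha_k+1)x^2}}}\quad\text{if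 } k \text{ is odd},$$ $$f_k(x)=\frac{2D_k}{1+\sqrt{1-\frac{2\alpha_k}{(\beta_k^{(1)}+\beta_k^{(2)}+1)(\alpha_k+1)x^2}}}\quad\text{if } k \text{ is even}.$$ *)

theory Defs
  imports "HOL-Analysis.Analysis" "HOL-Library.Omega_Words_Fun"
begin

(* The infimum is attained. *)
definition dist_int :: "real \<Rightarrow> real" where
  "dist_int x = (INF a::int. \<bar>x - of_int a\<bar>)"

(* Only meaningful for t \<ge> 1, where the set of admissible q is finite and nonempty. *)
definition psi :: "real \<Rightarrow> real \<Rightarrow> real" where
  "psi \<alpha> t = (MIN q\<in>{q::int. 1 \<le> q \<and> of_int q \<le> t}. dist_int (of_int q * \<alpha>))"

(* cf_conv a n = [a 0; a 1, ..., a n] *)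
fun cf_conv :: "(nat \<Rightarrow> int) \<Rightarrow> nat \<Rightarrow> real" where
  "cf_conv a 0 = of_int (a 0)"
| "cf_conv a (Suc n) = of_int (a 0) + 1 / cf_conv (\<lambda>i. a (Suc i)) n"

definition cf_value :: "(nat \<Rightarrow> int) \<Rightarrow> real" where
  "cf_value a = lim (cf_conv a)"

(* x = [a 0; a 1, a 2, ...] as an infinite regular continued fraction *)
definition is_cf_of :: "(nat \<Rightarrow> int) \<Rightarrow> real \<Rightarrow> bool" where
  "is_cf_of a x \<longleftrightarrow> (\<forall>j\<ge>1. a j \<ge> 1) \<and> cf_conv a \<longlonglongrightarrow> x"

definition cf_equiv :: "real \<Rightarrow> real \<Rightarrow> bool" where
  "cf_equiv \<alpha> \<beta> \<longleftrightarrow> (\<exists>a b. is_cf_of a \<alpha> \<and> is_cf_of b \<beta> \<and>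
     (\<exists>n0 m0. \<forall>s\<ge>1. a (n0 + s) = b (m0 + s)))"

(* Periodic expansions are written with the omega-word operations:
   v\<^sup>\<omega> repeats the list v forever, and u \<frown> w prepends the list u to the sequence w. *)
definition alpha :: "nat \<Rightarrow> real" where
  "alpha k = (if k = 0 then cf_value ([1]\<^sup>\<omega>)
              else cf_value ((replicate (2 * k - 1) 1 @ [2])\<^sup>\<omega>))"

definition Dk :: "nat \<Rightarrow> real" where
  "Dk k = (2 * alpha k + 1) / (2 * alpha k + 2)"

definition beta :: "nat \<Rightarrow> real" where
  "beta k = cf_value ((0 # replicate (k - 1) 1) \<frown> (2 # replicate (2 * k - 1) 1)\<^sup>\<omega>)"

definition beta1 :: "nat \<Rightarrow> real" where
  "beta1 k = cf_value ((0 # replicate k 1) \<frown> (2 # replicate (2 * k - 1) 1)\<^sup>\<omega>)"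

definition beta2 :: "nat \<Rightarrow> real" where
  "beta2 k = cf_value ((0 # replicate (k - 2) 1) \<frown> (2 # replicate (2 * k - 1) 1)\<^sup>\<omega>)"

definition fk :: "nat \<Rightarrow> real \<Rightarrow> real" where
  "fk k x = (if odd k
     then 2 * Dk k / (1 + sqrt (1 - 2 * alpha k / ((2 * beta k + 1) * (alpha k + 1) * x\<^sup>2)))
     else 2 * Dk k / (1 + sqrt (1 - 2 * alpha k / ((beta1 k + beta2 k + 1) * (alpha k + 1) * x\<^sup>2))))"

end

(* Index the convergents so that q_0 = 0, q_1 = 1 and q_(n+1) = a_n q_n + q_(n-1).
   On q_n <= t < q_(n+1) the function psi equals |q_n alpha - p_n|, and the left limit of t psi(t)
   at q_(n+1) is 1/(1 + v_n), where v_n is the product of q_n/q_(n+1) = [0; a_n, ..., a_1] and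
   [0; a_(n+1), a_(n+2), ...].  Let A, B, C be the Fibonacci numbers F_2k, F_(2k+1), F_(2k+2).

   If the expansion of alpha ends in the period of alpha_k, the values next to a partial quotient 2
   are exact functions of the integer G = A x^2 - C y^2 at x = q_(n-1) + q_n, y = q_n.  The identity
     G = 2 F_k F_(k+1) (x^2 - x y - y^2) - (F_k x - F_(k+1) y)^2
   and a descent along an automorph show that G <= -c or G >= A, where c = 2 F_k F_(k+1) for odd k
   and c = 2 F_k F_(k+1) + 1 for even k; f_k is the value for G = -c.  At one of the two
   positions next to the 2 the value is therefore at least f_k, and G = -c throughout for the numbers beta.

   If v_n > U/(2 + U) eventually, with U = B/C, then the partial quotients are eventually 1 or 2, the
   twos are isolated, and the blocks of ones between them have equal odd lengths at most 2k - 1, so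
   alpha is equivalent to some alpha_j with j <= k.  For every other alpha, infinitely many values
   exceed D_k by a fixed amount, hence also f_k(q). *)

theory Submission
  imports Defs "HOL-Number_Theory.Fib"
begin

section \<open>Complete quotients and convergents\<close>

text \<open>\<open>fk\<close> lies strictly above \<open>Dk\<close> and tends to it, so exceeding
  D_k is not enough: the excess has to be measured. Put w = \<open>fib_root k\<close> = sqrt (C/A).
  A 2 with the same tail w - 1 on both sides has v = (w-1)/(w+1), and the value is exactly D_k. When
  the expansion ends in the period of alpha_k, the right tail at a 2 is w - 1 and the left tail is a
  rational number near it. The sign of G tells on which side of w - 1 it lies: G < 0 raises the
  value before the 2 above D_k, G > 0 the value after it. Since G is an integer with a gap in its
  values, the excess is bounded below. For other expansions a fixed excess is available, because w -
  1 may be replaced by the smaller number U. The choice U = B/C works for two reasons. First, B/C =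
  [0; 1_(2k-1), 2] is below [0; 1_(2k-1), 1 + w] = w - 1. Second, B/C = [0; 1_(2k+1)] is above every
  [0; 1_(2k), z] with z > 1, so a tail larger than U cannot begin with 2k ones.\<close>

locale complete_quotients =
  fixes a :: "nat \<Rightarrow> int" and X :: "nat \<Rightarrow> real"
  assumes quot_ge_1: "j \<ge> 1 \<Longrightarrow> a j \<ge> 1"
    and cq_gt_1: "j \<ge> 1 \<Longrightarrow> X j > 1"
    and cq_rec: "X n = of_int (a n) + 1 / X (Suc n)"

lemma complete_quotients_shift:
  assumes "complete_quotients a X"
  shows "complete_quotients (\<lambda>i. a (m + i)) (\<lambda>i. X (m + i))"
proof -
  interpret complete_quotients a X by fact
  show ?thesis
  proof
    show "X (m + n) = of_int (a (m + n)) + 1 / X (m + Suc n)" for n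
      unfolding add_Suc_right by (rule cq_rec)
  qed (auto intro: quot_ge_1 cq_gt_1)
qed

lemma cf_conv_ge_1:
  assumes "\<And>j. a j \<ge> 1"
  shows "cf_conv a n \<ge> 1"
  using assms
proof (induction n arbitrary: a)
  case 0
  have "a 0 \<ge> 1" using 0 by blast
  then show ?case by simp
next
  case (Suc n)
  have "cf_conv (\<lambda>i. a (Suc i)) n \<ge> 1" by (rule Suc.IH) (rule Suc.prems)
  moreover have "real_of_int (a 0) \<ge> 1" using Suc.prems[of 0] by simp
  ultimately show ?case by (simp add: add_increasing2)
qed

text \<open>The single step c -> 1/c has slope near -1 at c = 1 and gives no uniform contraction.
  Two steps have the difference quotient 1/((ac+1)(ax+1)) <= 1/4, hence the rate 1/2 per index in
  \<open>cf_conv_error\<close>.\<close>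

lemma reciprocal_diff_two_steps:
  fixes c x :: real
  assumes "c \<ge> 1" "x \<ge> 1" "a \<ge> 1"
  shows "\<bar>1 / (a + 1 / c) - 1 / (a + 1 / x)\<bar> \<le> \<bar>c - x\<bar> / 4"
proof -
  have p: "a * c + 1 \<ge> 2" "a * x + 1 \<ge> 2"
    using mult_mono[of 1 a 1 c] mult_mono[of 1 a 1 x] assms by auto
  have "1 / (a + 1 / c) - 1 / (a + 1 / x) = c / (a * c + 1) - x / (a * x + 1)"
    using assms by (simp add: field_simps)
  also have "\<dots> = (c - x) / ((a * c + 1) * (a * x + 1))"
    using p by (simp add: divide_simps) (simp add: algebra_simps)
  finally have e: "\<bar>1 / (a + 1 / c) - 1 / (a + 1 / x)\<bar> = \<bar>c - x\<bar> / ((a * c + 1) * (a * x + 1))"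
    using p by (simp add: abs_mult)
  have "(a * c + 1) * (a * x + 1) \<ge> 2 * 2" by (rule mult_mono) (use p in auto)
  then show ?thesis unfolding e by (intro divide_left_mono) auto
qed

lemma cf_conv_error:
  assumes "complete_quotients a X"
  shows "\<bar>cf_conv a n - X 0\<bar> \<le> 2 * (1 / 2) ^ n"
  using assms
proof (induction n arbitrary: a X rule: induct_nat_012)
  case 0
  interpret complete_quotients a X by fact
  have "X 1 > 1" by (rule cq_gt_1) simp
  then have "1 / X 1 \<le> 1" "1 / X 1 \<ge> 0" by auto
  then show ?case using cq_rec[of 0] by simp
next
  case 1
  interpret complete_quotients a X by fact
  have x: "X 1 > 1" and a: "real_of_int (a 1) \<ge> 1" using cq_gt_1[of 1] quot_ge_1[of 1] by auto
  have "1 / X 1 \<le> 1" "1 / X 1 \<ge> 0" "1 / real_of_int (a 1) \<le> 1" "1 / real_of_int (a 1) \<ge> 0"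
    using x a by auto
  then have "\<bar>1 / real_of_int (a 1) - 1 / X 1\<bar> \<le> 1" by linarith
  then show ?case using cq_rec[of 0] by simp
next
  case (ge2 n)
  interpret complete_quotients a X by fact
  have "complete_quotients (\<lambda>i. a (2 + i)) (\<lambda>i. X (2 + i))"
    by (rule complete_quotients_shift) fact
  from ge2.IH(1)[OF this]
  have ih: "\<bar>cf_conv (\<lambda>i. a (Suc (Suc i))) n - X 2\<bar> \<le> 2 * (1 / 2) ^ n"
    by (simp add: numeral_2_eq_2)
  have "\<bar>1 / (a 1 + 1 / cf_conv (\<lambda>i. a (Suc (Suc i))) n) - 1 / (a 1 + 1 / X 2)\<bar>
      \<le> \<bar>cf_conv (\<lambda>i. a (Suc (Suc i))) n - X 2\<bar> / 4"
    by (rule reciprocal_diff_two_steps)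
       (use cq_gt_1[of 2] quot_ge_1[of 1] in \<open>auto intro!: cf_conv_ge_1 quot_ge_1\<close>)
  moreover have "X 0 = a 0 + 1 / (a 1 + 1 / X 2)"
    using cq_rec[of 0] cq_rec[of 1] by (simp add: numeral_2_eq_2)
  ultimately show ?case using ih by simp
qed

lemma cf_conv_tendsto:
  assumes "complete_quotients a X"
  shows "cf_conv a \<longlonglongrightarrow> X 0"
proof -
  have "(\<lambda>n. 2 * (1 / 2) ^ n :: real) \<longlonglongrightarrow> 2 * 0"
    by (intro tendsto_intros LIMSEQ_power_zero) auto
  then have "(\<lambda>n. 2 * (1 / 2) ^ n :: real) \<longlonglongrightarrow> 0" by simp
  then have "(\<lambda>n. cf_conv a n - X 0) \<longlonglongrightarrow> 0"
    by (rule Lim_null_comparison[rotated]) (simp add: cf_conv_error[OF assms])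
  then show ?thesis by (simp add: LIM_zero_iff)
qed

lemma cf_value_eq: "complete_quotients a X \<Longrightarrow> cf_value a = X 0"
  unfolding cf_value_def by (intro limI cf_conv_tendsto)

lemma is_cf_of_cq: "complete_quotients a X \<Longrightarrow> is_cf_of a (X 0)"
  unfolding is_cf_of_def using cf_conv_tendsto complete_quotients.quot_ge_1 by blast

text \<open>A complete quotient is the limit of the convergents of the shifted sequence. This
  carries the closed formulas for periodic words over to every number whose expansion ends in such a
  word.\<close>

lemma complete_quotients_unique:
  assumes "complete_quotients a X" "complete_quotients b Y" "\<And>s. a (i + s) = b (j + s)"
  shows "X (i + s) = Y (j + s)"
proof -
  have "complete_quotients (\<lambda>r. a (i + s + r)) (\<lambda>r. X (i + s + r))"
       "complete_quotients (\<lambda>r. b (j + s + r)) (\<lambda>r. Y (j + s + r))"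
    by (intro complete_quotients_shift assms)+
  moreover have "(\<lambda>r. a (i + s + r)) = (\<lambda>r. b (j + s + r))"
    using assms(3) by (simp add: add.assoc)
  ultimately show ?thesis
    using cf_value_eq[of "\<lambda>r. a (i + s + r)"] cf_value_eq[of "\<lambda>r. b (j + s + r)"] by fastforce
qed

text \<open>\<open>X\<close> is the orbit under x -> 1 / frac x; irrationality persists along it, so
  no fractional part vanishes.\<close>

lemma irrational_complete_quotients:
  fixes \<alpha> :: real
  assumes "\<alpha> \<notin> \<rat>"
  obtains a X where "complete_quotients a X" "X 0 = \<alpha>"
proof -
  define X where "X n = ((\<lambda>x. 1 / frac x) ^^ n) \<alpha>" for n
  define a where "a n = \<lfloor>X n\<rfloor>" for n
  have XS: "X (Suc n) = 1 / frac (X n)" for n unfolding X_def by simp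
  have irr: "X n \<notin> \<rat>" for n
  proof (induction n)
    case (Suc n)
    show ?case
    proof
      assume "X (Suc n) \<in> \<rat>"
      then have "1 / X (Suc n) + of_int \<lfloor>X n\<rfloor> \<in> \<rat>" by simp
      then show False using Suc XS by (simp add: frac_def)
    qed
  qed (use assms in \<open>simp add: X_def\<close>)
  have f: "0 < frac (X n)" "frac (X n) < 1" for n
  proof -
    have "X n \<notin> \<int>" using irr[of n] Ints_subset_Rats by blast
    then show "0 < frac (X n)" by simp
  qed (rule frac_lt_1)
  have gt: "X (Suc n) > 1" for n using f[of n] XS by simp
  have gt': "X j > 1" if "j \<ge> 1" for j using gt[of "j - 1"] that by simp
  have "complete_quotients a X"
  proof
    show "a j \<ge> 1" if "j \<ge> 1" for j using gt'[OF that] unfolding a_def by simp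
    show "X n = of_int (a n) + 1 / X (Suc n)" for n
      by (simp add: XS a_def frac_def)
  qed (rule gt')
  moreover have "X 0 = \<alpha>" by (simp add: X_def)
  ultimately show ?thesis using that by blast
qed

section \<open>Denominators, approximation errors and the values of psi\<close>

fun cf_den :: "(nat \<Rightarrow> int) \<Rightarrow> nat \<Rightarrow> int" where
  "cf_den a 0 = 0"
| "cf_den a (Suc 0) = 1"
| "cf_den a (Suc (Suc n)) = a (Suc n) * cf_den a (Suc n) + cf_den a n"

fun cf_num :: "(nat \<Rightarrow> int) \<Rightarrow> nat \<Rightarrow> int" where
  "cf_num a 0 = 1"
| "cf_num a (Suc 0) = a 0"
| "cf_num a (Suc (Suc n)) = a (Suc n) * cf_num a (Suc n) + cf_num a n"

lemma cf_det: "cf_num a n * cf_den a (Suc n) - cf_num a (Suc n) * cf_den a n = (-1) ^ n"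
  by (induction n) (auto simp: algebra_simps)

lemma dist_int_le: "dist_int x \<le> \<bar>x - of_int c\<bar>"
  unfolding dist_int_def by (rule cINF_lower) (auto intro!: bdd_belowI[of _ 0])

context complete_quotients
begin

abbreviation "Q \<equiv> cf_den a"
abbreviation "P \<equiv> cf_num a"

definition err :: "nat \<Rightarrow> real" where "err n = of_int (Q n) * X 0 - of_int (P n)"

lemma err_Suc: "err (Suc n) = - err n / X (Suc n)"
proof (induction n)
  case 0
  show ?case using cq_rec[of 0] by (simp add: err_def)
next
  case (Suc n)
  have "err (Suc (Suc n)) = of_int (a (Suc n)) * err (Suc n) + err n"
    by (simp add: err_def algebra_simps)
  also have "err n = - X (Suc n) * err (Suc n)"
    using Suc cq_gt_1[of "Suc n"] by (simp add: field_simps)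
  also have "of_int (a (Suc n)) * err (Suc n) + - X (Suc n) * err (Suc n)
      = - err (Suc n) / X (Suc (Suc n))"
    using cq_rec[of "Suc n"] by (simp add: algebra_simps)
  finally show ?case .
qed

lemma abs_err_Suc: "\<bar>err (Suc n)\<bar> = \<bar>err n\<bar> / X (Suc n)"
  using err_Suc[of n] cq_gt_1[of "Suc n"] by simp

lemma err_sgn: "err n * (-1) ^ Suc n > 0"
proof (induction n)
  case 0
  show ?case by (simp add: err_def)
next
  case (Suc n)
  have "err (Suc n) * (-1) ^ Suc (Suc n) = err n * (-1) ^ Suc n / X (Suc n)"
    using err_Suc[of n] by simp
  then show ?case using divide_pos_pos[OF Suc, of "X (Suc n)"] cq_gt_1[of "Suc n"] by simp
qed

lemma abs_err: "\<bar>err n\<bar> = err n * (-1) ^ Suc n"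
  using err_sgn[of n] by (cases "even n") auto

lemma abs_err_pos: "\<bar>err n\<bar> > 0"
  using err_sgn[of n] abs_err[of n] by simp

lemma Q_Suc_pos: "Q (Suc n) \<ge> 1"
proof (induction n rule: induct_nat_012)
  case (ge2 n)
  have "a (Suc (Suc n)) * Q (Suc (Suc n)) \<ge> 1 * 1"
    by (rule mult_mono) (use ge2 quot_ge_1[of "Suc (Suc n)"] in auto)
  then show ?case using ge2 by simp
qed (use quot_ge_1[of 1] in auto)

lemma Q_nonneg: "Q n \<ge> 0"
  using Q_Suc_pos[of "n - 1"] by (cases n) auto

lemma Q_le_Suc: "Q n \<le> Q (Suc n)"
proof (cases n)
  case (Suc m)
  have "1 * Q (Suc m) \<le> a (Suc m) * Q (Suc m)"
    by (rule mult_right_mono) (use quot_ge_1[of "Suc m"] Q_nonneg in auto)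
  then show ?thesis using Suc Q_nonneg[of m] by simp
qed simp

text \<open>Strictness can fail at n = 1: \<open>Q 1 = Q 2\<close> if the first partial quotient
  after the integer part is 1.\<close>

lemma Q_less_Suc: "n \<ge> 2 \<Longrightarrow> Q n < Q (Suc n)"
proof -
  assume "n \<ge> 2"
  then obtain m where m: "n = Suc (Suc m)" by (metis add_2_eq_Suc le_Suc_ex)
  have "1 * Q n \<le> a n * Q n"
    by (rule mult_right_mono) (use m quot_ge_1[of n] Q_nonneg[of n] in auto)
  then show ?thesis using m Q_Suc_pos[of m] by simp
qed

lemma Q_mono: "m \<le> n \<Longrightarrow> Q m \<le> Q n"
  by (rule lift_Suc_mono_le[of Q]) (rule Q_le_Suc)

lemma Q_ge_index: "Q (Suc n) \<ge> int n"
proof (induction n)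
  case (Suc n)
  show ?case
  proof (cases "n = 0")
    case False
    then show ?thesis using Suc Q_less_Suc[of "Suc n"] by simp
  qed (use Q_Suc_pos[of 1] in simp)
qed simp

text \<open>This is \<open>cf_det\<close> expressed by the errors; their alternating signs turn the
  difference into a sum of absolute values.\<close>

lemma Q_err_identity: "of_int (Q (Suc n)) * \<bar>err n\<bar> + of_int (Q n) * \<bar>err (Suc n)\<bar> = 1"
proof -
  have "of_int (P n) * of_int (Q (Suc n)) - of_int (P (Suc n)) * of_int (Q n) = ((-1) ^ n :: real)"
    using arg_cong[OF cf_det[of a n], of real_of_int] by simp
  then have "(- err n * of_int (Q (Suc n)) + of_int (Q n) * err (Suc n)) * (-1) ^ n = (1::real)"
    by (simp add: err_def algebra_simps)
  then show ?thesis unfolding abs_err by (simp add: algebra_simps)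
qed

definition ratio :: "nat \<Rightarrow> real" where "ratio n = of_int (Q n) / of_int (Q (Suc n))"

lemma ratio_bounds: "0 \<le> ratio n" "ratio n \<le> 1"
  using Q_nonneg[of n] Q_le_Suc[of n] Q_Suc_pos[of n] by (auto simp: ratio_def divide_simps)

lemma ratio_Suc: "ratio (Suc n) = 1 / (of_int (a (Suc n)) + ratio n)"
  using Q_Suc_pos[of n] by (simp add: ratio_def field_simps)

definition v :: "nat \<Rightarrow> real" where "v n = ratio n / X (Suc n)"

lemma v_nonneg: "v n \<ge> 0"
  using ratio_bounds[of n] cq_gt_1[of "Suc n"] by (simp add: v_def)

lemma Q_err_eq: "of_int (Q (Suc n)) * \<bar>err n\<bar> = 1 / (1 + v n)"
proof -
  have "of_int (Q (Suc n)) * \<bar>err n\<bar> * (1 + v n) = 1"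
    using Q_err_identity[of n] Q_Suc_pos[of n] unfolding abs_err_Suc v_def ratio_def
    by (simp add: field_simps)
  then show ?thesis using v_nonneg[of n] by (simp add: field_simps)
qed

text \<open>Written in the basis of two consecutive convergents, \<open>(c, q)\<close> has coefficients of
  opposite signs, so the two errors, which also alternate in sign, add up.\<close>

lemma best_approximation:
  assumes "1 \<le> q" "q < Q (Suc n)"
  shows "\<bar>err n\<bar> \<le> \<bar>of_int q * X 0 - of_int c\<bar>"
proof -
  define r where "r = (-1) ^ n * (c * Q (Suc n) - q * P (Suc n))"
  define s where "s = (-1) ^ n * (q * P n - c * Q n)"
  have m: "(-1) ^ n * (-1) ^ n = (1::int)" by (simp flip: power_add)
  have q: "q = r * Q n + s * Q (Suc n)"
  proof -
    have "r * Q n + s * Q (Suc n) = (-1) ^ n * (q * (P n * Q (Suc n) - P (Suc n) * Q n))"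
      unfolding r_def s_def by (simp add: algebra_simps)
    then show ?thesis unfolding cf_det using m by simp
  qed
  have c: "c = r * P n + s * P (Suc n)"
  proof -
    have "r * P n + s * P (Suc n) = (-1) ^ n * (c * (P n * Q (Suc n) - P (Suc n) * Q n))"
      unfolding r_def s_def by (simp add: algebra_simps)
    then show ?thesis unfolding cf_det using m by simp
  qed
  have e: "of_int q * X 0 - of_int c = of_int r * err n + of_int s * err (Suc n)"
    unfolding err_def by (subst q, subst c) (simp add: algebra_simps)
  also have "\<dots> = (- of_int r * \<bar>err n\<bar> + of_int s * \<bar>err (Suc n)\<bar>) * (-1) ^ n"
    unfolding abs_err by (simp add: algebra_simps)
  finally have e: "\<bar>of_int q * X 0 - of_int c\<bar> = \<bar>of_int s * \<bar>err (Suc n)\<bar> - of_int r * \<bar>err n\<bar>\<bar>"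
    by (simp add: abs_mult)
  have "r \<noteq> 0"
  proof
    assume "r = 0"
    then have "q = s * Q (Suc n)" using q by simp
    then have "Q (Suc n) dvd q" by simp
    then show False using assms zdvd_imp_le by force
  qed
  then consider "r \<ge> 1" | "r \<le> -1" by linarith
  then show ?thesis
  proof cases
    case 1
    have "s \<le> 0"
    proof (rule ccontr)
      assume "\<not> s \<le> 0"
      then have "1 * Q (Suc n) \<le> s * Q (Suc n)" by (intro mult_right_mono) (use Q_nonneg in auto)
      moreover have "r * Q n \<ge> 0" using 1 Q_nonneg[of n] by simp
      ultimately show False using q assms by linarith
    qed
    then have "of_int s * \<bar>err (Suc n)\<bar> \<le> 0" by (simp add: mult_nonpos_nonneg)
    moreover have "1 * \<bar>err n\<bar> \<le> of_int r * \<bar>err n\<bar>" using 1 by (intro mult_right_mono) auto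
    ultimately show ?thesis unfolding e by linarith
  next
    case 2
    have "s \<ge> 0"
    proof (rule ccontr)
      assume "\<not> s \<ge> 0"
      then have "s * Q (Suc n) \<le> 0" using Q_nonneg[of "Suc n"] by (simp add: mult_nonpos_nonneg)
      moreover have "r * Q n \<le> 0" using 2 Q_nonneg[of n] by (simp add: mult_nonpos_nonneg)
      ultimately show False using q assms by linarith
    qed
    then have "of_int s * \<bar>err (Suc n)\<bar> \<ge> 0" by simp
    moreover have "1 * \<bar>err n\<bar> \<le> - of_int r * \<bar>err n\<bar>" using 2 by (intro mult_right_mono) auto
    ultimately show ?thesis unfolding e by linarith
  qed
qed

lemma psi_eq:
  assumes "n \<ge> 1" "of_int (Q n) \<le> t" "t < of_int (Q (Suc n))"
  shows "psi (X 0) t = \<bar>err n\<bar>"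
proof -
  let ?S = "{q::int. 1 \<le> q \<and> of_int q \<le> t}"
  have Q1: "Q n \<ge> 1" using Q_Suc_pos[of "n - 1"] assms by simp
  have fin: "finite ?S"
    by (rule finite_subset[of _ "{1..\<lfloor>t\<rfloor>}"]) (auto simp: le_floor_iff)
  have ge: "\<bar>err n\<bar> \<le> dist_int (of_int q * X 0)" if "q \<in> ?S" for q
    unfolding dist_int_def
  proof (rule cINF_greatest)
    fix c :: int
    have "of_int q < (of_int (Q (Suc n)) :: real)" using that assms(3) by simp
    then have "q < Q (Suc n)" by simp
    then show "\<bar>err n\<bar> \<le> \<bar>of_int q * X 0 - of_int c\<bar>"
      using that by (intro best_approximation) auto
  qed auto
  have mem: "Q n \<in> ?S" using Q1 assms by auto
  have "dist_int (of_int (Q n) * X 0) \<le> \<bar>err n\<bar>"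
    unfolding err_def by (rule dist_int_le)
  with ge[OF mem] have eq: "dist_int (of_int (Q n) * X 0) = \<bar>err n\<bar>" by simp
  show ?thesis unfolding psi_def
  proof (rule Min_eqI)
    show "finite ((\<lambda>q. dist_int (of_int q * X 0)) ` ?S)" using fin by simp
    show "\<bar>err n\<bar> \<in> (\<lambda>q. dist_int (of_int q * X 0)) ` ?S"
      using eq mem by (intro image_eqI[of _ _ "Q n"]) simp_all
  qed (use ge in auto)
qed

lemma psi_left_limit:
  assumes "n \<ge> 2"
  shows "((\<lambda>t. t * psi (X 0) t) \<longlongrightarrow> 1 / (1 + v n)) (at_left (of_int (Q (Suc n))))"
proof -
  have "((\<lambda>t. t * \<bar>err n\<bar>) \<longlongrightarrow> of_int (Q (Suc n)) * \<bar>err n\<bar>) (at_left (of_int (Q (Suc n))))"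
    by (intro tendsto_intros)
  moreover have "\<forall>\<^sub>F t in at_left (of_int (Q (Suc n))). t * \<bar>err n\<bar> = t * psi (X 0) t"
    using Q_less_Suc[OF assms] assms psi_eq[of n]
    by (intro eventually_at_leftI[of "of_int (Q n)"]) auto
  ultimately show ?thesis unfolding Q_err_eq by (rule Lim_transform_eventually)
qed

lemma psi_bound_between:
  assumes "t \<ge> of_int (Q 2)"
  obtains n where "n \<ge> 2" "of_int (Q n) \<le> t" "t < of_int (Q (Suc n))"
    "t * psi (X 0) t < 1 / (1 + v n)"
proof -
  define m where "m = (LEAST m. t < of_int (Q m))"
  have "t < of_int (Q (Suc (nat \<lceil>t\<rceil> + 1)))"
    using Q_ge_index[of "nat \<lceil>t\<rceil> + 1"] by linarith
  then have m: "t < of_int (Q m)" unfolding m_def by (rule LeastI)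
  have "m > 2"
  proof (rule ccontr)
    assume "\<not> m > 2"
    then have "Q m \<le> Q 2" by (intro Q_mono) simp
    then show False using m assms by (metis leD le_less_trans of_int_le_iff)
  qed
  then obtain n where n: "m = Suc n" "n \<ge> 2" by (cases m) auto
  have le: "of_int (Q n) \<le> t" using n not_less_Least[of n "\<lambda>m. t < of_int (Q m)"] by (simp add: m_def)
  have "t * psi (X 0) t = t * \<bar>err n\<bar>" using psi_eq[of n t] n m le by simp
  also have "\<dots> < of_int (Q (Suc n)) * \<bar>err n\<bar>"
    using m n abs_err_pos by (intro mult_strict_right_mono) auto
  finally show ?thesis using that[of n] n m le unfolding Q_err_eq by simp
qed

end

section \<open>A quadratic form with Fibonacci coefficients\<close>

lemma fib_Suc_pos: "fib (Suc n) > 0"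
  by (rule fib_neq_0_nat) simp

lemma fib_Suc_sq: "(int (fib (Suc k)))\<^sup>2 - int (fib (Suc k)) * int (fib k) - (int (fib k))\<^sup>2 = (-1) ^ k"
  by (induction k) (auto simp: power2_eq_square algebra_simps)

lemma fib_double:
  "int (fib (2 * k)) = int (fib k) * (2 * int (fib (Suc k)) - int (fib k))"
  "int (fib (Suc (2 * k))) = (int (fib k))\<^sup>2 + (int (fib (Suc k)))\<^sup>2"
  by (induction k) (auto simp: power2_eq_square algebra_simps)

lemma fib_even_cassini:
  "(int (fib (Suc (2 * k))))\<^sup>2 - int (fib (2 * k)) * int (fib (Suc (Suc (2 * k)))) = 1"
  using fib_Suc_sq[of "2 * k"] by (simp add: power2_eq_square algebra_simps)

lemma real_fib_even_cassini:
  "(real (fib (Suc (2 * k))))\<^sup>2 - real (fib (2 * k)) * real (fib (Suc (Suc (2 * k)))) = 1"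
  using arg_cong[OF fib_even_cassini[of k], of real_of_int] by (simp del: fib.simps)

definition fib_form :: "nat \<Rightarrow> int \<Rightarrow> int \<Rightarrow> int" where
  "fib_form k x y = int (fib (2 * k)) * x\<^sup>2 - int (fib (Suc (Suc (2 * k)))) * y\<^sup>2"

text \<open>For k >= 1, - \<open>fib_gap k\<close> is the largest negative value of the form at
  nonnegative integer vectors: \<open>fib_form_gap\<close> gives the bound and
  \<open>fib_form_start\<close> the equality. The extra 1 for even k is the least nonzero
  square.\<close>

definition fib_gap :: "nat \<Rightarrow> int" where
  "fib_gap k = 2 * int (fib k) * int (fib (Suc k)) + (if odd k then 0 else 1)"

lemma fib_form_golden:
  "fib_form k x y = 2 * int (fib k) * int (fib (Suc k)) * (x\<^sup>2 - x * y - y\<^sup>2)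
     - (int (fib k) * x - int (fib (Suc k)) * y)\<^sup>2"
proof -
  have "int (fib (Suc (Suc (2 * k)))) = int (fib (Suc (2 * k))) + int (fib (2 * k))" by simp
  then show ?thesis unfolding fib_form_def fib_double
    by (simp only:) (simp add: fib_double, algebra)
qed

text \<open>Modulo 2 the form vanishes only at (0, 0), so a nontrivial zero could be halved
  forever.\<close>

lemma golden_form_nonzero:
  fixes x y :: int
  assumes "x\<^sup>2 - x * y - y\<^sup>2 = 0"
  shows "x = 0 \<and> y = 0"
  using assms
proof (induction "nat (\<bar>x\<bar> + \<bar>y\<bar>)" arbitrary: x y rule: less_induct)
  case less
  have "even (x\<^sup>2 - x * y - y\<^sup>2)" using less.prems by simp
  then have "even x" "even y" by (auto simp: power2_eq_square)
  then obtain u w where uw: "x = 2 * u" "y = 2 * w" by (metis evenE)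
  have u: "u\<^sup>2 - u * w - w\<^sup>2 = 0"
    using less.prems unfolding uw by (simp add: power2_eq_square)
  show ?case
  proof (rule ccontr)
    assume ne: "\<not> (x = 0 \<and> y = 0)"
    then have "nat (\<bar>u\<bar> + \<bar>w\<bar>) < nat (\<bar>x\<bar> + \<bar>y\<bar>)" unfolding uw by auto
    from less.hyps[OF this u] ne uw show False by simp
  qed
qed

text \<open>Integrality gives M <= -1 in \<open>fib_form_golden\<close>. For even k the square adds
  at least 1: if it vanished, (x, y) would be proportional to (F_(k+1), F_k), where the golden form
  is (-1)^k > 0.\<close>

lemma fib_form_golden_neg:
  assumes k: "k \<ge> 1" and assms: "x\<^sup>2 - x * y - y\<^sup>2 < 0"
  shows "fib_form k x y \<le> - fib_gap k"
proof -
  let ?f = "int (fib k)" and ?g = "int (fib (Suc k))"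
  define M where "M = x\<^sup>2 - x * y - y\<^sup>2"
  define b where "b = ?f * x - ?g * y"
  have G: "fib_form k x y = 2 * ?f * ?g * M - b\<^sup>2"
    unfolding M_def b_def by (rule fib_form_golden)
  have M: "2 * ?f * ?g * M \<le> 2 * ?f * ?g * (-1)"
  proof (rule mult_left_mono)
    show "M \<le> -1" using assms unfolding M_def by linarith
  qed simp
  show ?thesis
  proof (cases "odd k")
    case True
    then have "fib_gap k = 2 * ?f * ?g" by (simp add: fib_gap_def)
    then show ?thesis using G M zero_le_power2[of b] by linarith
  next
    case False
    have "b \<noteq> 0"
    proof
      assume "b = 0"
      then have e: "?f * x = ?g * y" by (simp add: b_def)
      have "?f\<^sup>2 * M = (?f * x)\<^sup>2 - (?f * x) * (?f * y) - (?f * y)\<^sup>2"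
        unfolding M_def by algebra
      also have "\<dots> = y\<^sup>2 * (?g\<^sup>2 - ?g * ?f - ?f\<^sup>2)" unfolding e by algebra
      also have "\<dots> = y\<^sup>2" using False unfolding fib_Suc_sq by simp
      finally have "?f\<^sup>2 * M = y\<^sup>2" .
      moreover have "?f\<^sup>2 * M < 0"
      proof (rule mult_pos_neg)
        show "?f\<^sup>2 > 0" using fib_neq_0_nat[of k] k by simp
        show "M < 0" using assms by (simp add: M_def)
      qed
      ultimately show False by (smt (verit) zero_le_power2)
    qed
    then have "b\<^sup>2 \<ge> 1" by (simp add: int_one_le_iff_zero_less)
    moreover have "fib_gap k = 2 * ?f * ?g + 1" using False by (simp add: fib_gap_def)
    ultimately show ?thesis using G M by linarith
  qed
qed

text \<open>On the cone \<open>F\<^sub>2\<^sub>k x \<ge> F\<^sub>2\<^sub>k\<^sub>+\<^sub>1 y\<close> the form dominates \<open>F\<^sub>2\<^sub>k\<close> times the golden form; the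
  remaining vectors are moved towards it by the automorph
  \<open>(F\<^sub>2\<^sub>k\<^sub>+\<^sub>1 x - F\<^sub>2\<^sub>k\<^sub>+\<^sub>2 y, F\<^sub>2\<^sub>k x - F\<^sub>2\<^sub>k\<^sub>+\<^sub>1 y)\<close>, which decreases \<open>\<bar>y\<bar>\<close>.\<close>

lemma fib_form_gap:
  assumes "k \<ge> 1" "x \<ge> 0" "y \<ge> 0" "x \<noteq> 0 \<or> y \<noteq> 0"
  shows "fib_form k x y \<le> - fib_gap k \<or> fib_form k x y \<ge> int (fib (2 * k))"
  using assms(2-)
proof (induction "nat y" arbitrary: x y rule: less_induct)
  case less
  define A where "A = int (fib (2 * k))"
  define B where "B = int (fib (Suc (2 * k)))"
  define M where "M = x\<^sup>2 - x * y - y\<^sup>2"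
  have C: "int (fib (Suc (Suc (2 * k)))) = A + B" by (simp add: A_def B_def)
  have det: "B\<^sup>2 - A * (A + B) = 1" using fib_even_cassini[of k] unfolding C A_def B_def by simp
  have form: "fib_form k x y = A * x\<^sup>2 - (A + B) * y\<^sup>2" for x y
    unfolding fib_form_def C A_def by simp
  have A: "A \<ge> 1" using assms(1) fib_neq_0_nat[of "2 * k"] unfolding A_def by linarith
  have "2 * k = Suc (2 * k - 1)" using assms(1) by simp
  then have "fib (Suc (2 * k)) = fib (2 * k) + fib (2 * k - 1)" by (metis fib.simps(3))
  moreover have "fib (2 * k - 1) > 0" using assms(1) by (intro fib_neq_0_nat) simp
  ultimately have B: "B \<ge> A + 1" unfolding A_def B_def by simp
  have "M \<noteq> 0" using golden_form_nonzero[of x y] less.prems unfolding M_def by auto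
  then consider "M < 0" | "M \<ge> 1" "A * x \<ge> B * y" | "M \<ge> 1" "A * x < B * y" by linarith
  then show ?case
  proof cases
    case 1
    then show ?thesis using fib_form_golden_neg assms(1) unfolding M_def by blast
  next
    case 2
    have "fib_form k x y = A * M + y * (A * x - B * y)" unfolding form M_def by algebra
    moreover have "A * M \<ge> A * 1" by (rule mult_left_mono) (use 2 A in auto)
    moreover have "y * (A * x - B * y) \<ge> 0" using 2 less.prems by simp
    ultimately show ?thesis unfolding A_def by linarith
  next
    case 3
    define x' where "x' = \<bar>B * x - (A + B) * y\<bar>"
    define y' where "y' = B * y - A * x"
    have "y > 0" using 3 A less.prems by (cases "y = 0") (auto simp: mult_less_0_iff)
    \<comment> \<open>This is y' < y. Otherwise s = A x is at most (B - 1) y; inserting this bound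
      and the determinant relation yields A^2 M <= (2 - 2B + A) y^2 <= 0, against M >= 1.\<close>
    have "A * x > (B - 1) * y"
    proof (rule ccontr)
      assume "\<not> A * x > (B - 1) * y"
      then have le: "A * x \<le> (B - 1) * y" by simp
      define s where "s = A * x"
      have s: "s \<ge> 0" "s \<le> (B - 1) * y" using le A less.prems by (auto simp: s_def)
      have "A\<^sup>2 * M = s * (s - A * y) - A\<^sup>2 * y\<^sup>2" unfolding M_def s_def by algebra
      also have "\<dots> \<le> ((B - 1) * y) * ((B - 1) * y - A * y) - A\<^sup>2 * y\<^sup>2"
      proof -
        have "s * (s - A * y) \<le> s * ((B - 1) * y - A * y)" by (rule mult_left_mono) (use s in auto)
        also have "\<dots> \<le> ((B - 1) * y) * ((B - 1) * y - A * y)"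
        proof (rule mult_right_mono)
          have "(B - 1) * y - A * y = (B - 1 - A) * y" by algebra
          then show "(B - 1) * y - A * y \<ge> 0" using B \<open>y > 0\<close> by simp
        qed (use s in auto)
        finally show ?thesis by simp
      qed
      also have "\<dots> = (B\<^sup>2 - 2 * B + 1 - A * B + A - A\<^sup>2) * y\<^sup>2" by algebra
      also have "B\<^sup>2 - 2 * B + 1 - A * B + A - A\<^sup>2 = 2 - 2 * B + A"
        using det by algebra
      also have "(2 - 2 * B + A) * y\<^sup>2 \<le> 0" using A B by (intro mult_nonpos_nonneg) auto
      finally have "A\<^sup>2 * M \<le> 0" .
      moreover have "A\<^sup>2 * M > 0" using A 3 by simp
      ultimately show False by simp
    qed
    then have y': "0 < y'" "y' < y" using 3 unfolding y'_def by (auto simp: algebra_simps)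
    have "fib_form k x' y' = fib_form k x y"
      unfolding form x'_def y'_def power2_abs using det by algebra
    moreover have "x' \<ge> 0" by (simp add: x'_def)
    ultimately show ?thesis using less.hyps[of y' x'] y' by auto
  qed
qed

text \<open>Rests on F_(2k+1) = 2 F_k F_(k+1) + F_(k-1)^2. It keeps the radicand in
  \<open>fk\<close> nonnegative for x >= 1, and it makes a form value of F_2k large enough for the
  place after a 2.\<close>

lemma fib_gap_le: "k \<ge> 1 \<Longrightarrow> fib_gap k \<le> int (fib (Suc (2 * k)))"
proof -
  assume k: "k \<ge> 1"
  let ?f = "int (fib k)" and ?g = "int (fib (Suc k))"
  have eq: "int (fib (Suc (2 * k))) = 2 * ?f * ?g + (?g - ?f)\<^sup>2"
    unfolding fib_double by algebra
  show ?thesis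
  proof (cases "odd k")
    case False
    then have "k \<ge> 2" using k by (cases "k = 1") auto
    then obtain m where m: "k = Suc (Suc m)" by (metis add_2_eq_Suc le_Suc_ex)
    have "?g - ?f = int (fib (Suc m))" using m by simp
    moreover have "fib (Suc m) > 0" by (intro fib_neq_0_nat) simp
    ultimately have "?g - ?f \<ge> 1" by linarith
    then have "(?g - ?f)\<^sup>2 \<ge> 1" by (simp add: int_one_le_iff_zero_less)
    then show ?thesis using False unfolding eq fib_gap_def by simp
  qed (simp add: eq fib_gap_def)
qed

lemma fib_gap_pos: "k \<ge> 1 \<Longrightarrow> fib_gap k > 0"
  using fib_neq_0_nat[of k] fib_neq_0_nat[of "Suc k"] unfolding fib_gap_def by simp

lemma fib_form_consecutive:
  "fib_form k (int (fib (Suc j))) (int (fib j)) = 2 * int (fib k) * int (fib (Suc k)) * (-1) ^ j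
     - (int (fib k) * int (fib (Suc j)) - int (fib (Suc k)) * int (fib j))\<^sup>2"
  unfolding fib_form_golden fib_Suc_sq ..

text \<open>At (F_(j+1), F_j) the golden form is (-1)^j and the squared term is F_k F_(j+1) -
  F_(k+1) F_j. A negative value of least size needs odd j as close to k as possible: j = k for odd
  k, but j = k + 1 or j = k - 1 for even k. This is why even k has two extremal numbers.\<close>

lemma fib_form_start:
  "odd k \<Longrightarrow> fib_form k (int (fib (Suc k))) (int (fib k)) = - fib_gap k"
  "even k \<Longrightarrow> fib_form k (int (fib (Suc (Suc k)))) (int (fib (Suc k))) = - fib_gap k"
  "even (Suc m) \<Longrightarrow> fib_form (Suc m) (int (fib (Suc m))) (int (fib m)) = - fib_gap (Suc m)"
proof -
  have "int (fib k) * int (fib (Suc (Suc k))) - int (fib (Suc k)) * int (fib (Suc k)) = - ((-1) ^ k)" for k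
    unfolding fib_Suc_sq[symmetric] by (simp add: power2_eq_square algebra_simps)
  note e = this
  show "odd k \<Longrightarrow> fib_form k (int (fib (Suc k))) (int (fib k)) = - fib_gap k"
    unfolding fib_form_consecutive fib_gap_def by simp
  show "even k \<Longrightarrow> fib_form k (int (fib (Suc (Suc k)))) (int (fib (Suc k))) = - fib_gap k"
    unfolding fib_form_consecutive fib_gap_def e by simp
  have e': "(int (fib (Suc m)) * int (fib (Suc m)) - int (fib (Suc (Suc m))) * int (fib m))\<^sup>2 = 1"
  proof -
    have "int (fib (Suc m)) * int (fib (Suc m)) - int (fib (Suc (Suc m))) * int (fib m) = (-1) ^ m"
      using e[of m] by (simp add: algebra_simps)
    then show ?thesis by (simp flip: power_mult)
  qed
  show "even (Suc m) \<Longrightarrow> fib_form (Suc m) (int (fib (Suc m))) (int (fib m)) = - fib_gap (Suc m)"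
    unfolding fib_form_consecutive fib_gap_def e' by simp
qed

text \<open>The matrix ((B, C), (A, B)) of determinant 1 describes one passage through the period of
  \<open>alpha k\<close>; see \<open>form_at_period\<close>.\<close>

lemma fib_form_automorph:
  "fib_form k (int (fib (Suc (2 * k))) * x + int (fib (Suc (Suc (2 * k)))) * y)
     (int (fib (2 * k)) * x + int (fib (Suc (2 * k))) * y) = fib_form k x y"
proof -
  define A where "A = int (fib (2 * k))"
  define B where "B = int (fib (Suc (2 * k)))"
  have C: "int (fib (Suc (Suc (2 * k)))) = A + B" by (simp add: A_def B_def)
  have det: "B\<^sup>2 - A * (A + B) = 1" using fib_even_cassini[of k] unfolding C A_def B_def by simp
  show ?thesis unfolding fib_form_def C unfolding A_def[symmetric] B_def[symmetric]
    using det by algebra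
qed

section \<open>The periodic continued fractions\<close>

text \<open>The slope x / y at which \<open>fib_form k\<close> vanishes. In the periodic words
  below, the complete quotient that starts at a 2 is 1 + \<open>fib_root k\<close>.\<close>

definition fib_root :: "nat \<Rightarrow> real" where
  "fib_root k = sqrt (real (fib (Suc (Suc (2 * k)))) / real (fib (2 * k)))"

lemma fib_even_pos: "k \<ge> 1 \<Longrightarrow> fib (2 * k) > 0"
  by (intro fib_neq_0_nat) simp

lemma fib_root_sq: "k \<ge> 1 \<Longrightarrow> (fib_root k)\<^sup>2 * real (fib (2 * k)) = real (fib (Suc (Suc (2 * k))))"
  using fib_even_pos[of k] unfolding fib_root_def by (simp add: real_sqrt_divide power_divide)

lemma fib_root_gt_1: "k \<ge> 1 \<Longrightarrow> fib_root k > 1"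
  using fib_even_pos[of k] fib_neq_0_nat[of "Suc (2 * k)"] unfolding fib_root_def by simp

text \<open>5/3 solves (1 + w)/(2w) = 4/5, the comparison made in \<open>value_between_ones\<close>.
  For k = 1 the root is sqrt 3, which is larger.\<close>

lemma fib_root_less: "k \<ge> 2 \<Longrightarrow> fib_root k < 5 / 3"
proof -
  assume "k \<ge> 2"
  then obtain m where m: "2 * k = Suc (Suc m)" "m \<ge> 2"
    using le_Suc_ex[of 2 "2 * k"] by auto
  have pos: "fib m > 0" using m by (intro fib_neq_0_nat) simp
  obtain l where l: "m = Suc l" using m by (cases m) auto
  have "fib l \<le> fib m" using l by (cases l) auto
  then have "real (fib (Suc m)) \<le> 2 * real (fib m)" unfolding l by simp
  then have "9 * real (fib (Suc (Suc (2 * k)))) < 25 * real (fib (2 * k))"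
    using pos unfolding m by simp
  then have "real (fib (Suc (Suc (2 * k)))) / real (fib (2 * k)) < (5 / 3)\<^sup>2"
    using fib_even_pos[of k] \<open>k \<ge> 2\<close> by (simp add: divide_simps)
  then show ?thesis unfolding fib_root_def by (intro real_less_lsqrt) auto
qed

text \<open>Squaring reduces the claim to (A + 2B)^2 A < (A + B)^3, and by B^2 - AC = 1 the two
  sides differ by exactly B.\<close>

lemma fib_ratio_less_root:
  assumes "k \<ge> 1"
  shows "real (fib (Suc (2 * k))) / real (fib (Suc (Suc (2 * k)))) < fib_root k - 1"
proof -
  define A B where "A = real (fib (2 * k))" and "B = real (fib (Suc (2 * k)))"
  have C: "real (fib (Suc (Suc (2 * k)))) = A + B" by (simp add: A_def B_def)
  have det: "B\<^sup>2 - A * (A + B) = 1" using real_fib_even_cassini[of k] by (simp add: A_def B_def add.commute)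
  have A: "A > 0" using fib_even_pos[OF assms] by (simp add: A_def)
  have B: "B > 0" using fib_neq_0_nat[of "Suc (2 * k)"] by (simp add: B_def)
  have "(A + B) ^ 3 - (A + 2 * B)\<^sup>2 * A = B"
    using det by algebra
  then have "(A + 2 * B)\<^sup>2 * A < (A + B) ^ 3" using B by linarith
  then have "((A + 2 * B) / (A + B))\<^sup>2 < (A + B) / A"
    using A B by (simp add: divide_simps power2_eq_square power3_eq_cube ac_simps)
  then have "(A + 2 * B) / (A + B) < sqrt ((A + B) / A)"
    by (rule real_less_rsqrt)
  moreover have "(A + 2 * B) / (A + B) = B / (A + B) + 1" using A B by (simp add: field_simps)
  ultimately show ?thesis unfolding fib_root_def C A_def[symmetric] B_def[symmetric] by simp
qed

text \<open>The complete quotient m places before the next 2, that is [1_m, 1 + w] with w =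
  \<open>fib_root k\<close>.\<close>

definition fib_quot :: "nat \<Rightarrow> nat \<Rightarrow> real" where
  "fib_quot k m = (real (fib (Suc m)) * fib_root k + real (fib (Suc (Suc m))))
     / (real (fib m) * fib_root k + real (fib (Suc m)))"

lemma fib_quot_denom_pos: "k \<ge> 1 \<Longrightarrow> real (fib m) * fib_root k + real (fib (Suc m)) > 0"
  using fib_root_gt_1[of k] fib_neq_0_nat[of "Suc m"]
  by (intro add_nonneg_pos) auto

lemma fib_quot_Suc: "k \<ge> 1 \<Longrightarrow> fib_quot k (Suc m) = 1 + 1 / fib_quot k m"
  using fib_quot_denom_pos[of k m] fib_quot_denom_pos[of k "Suc m"]
  unfolding fib_quot_def by (simp add: field_simps)

lemma fib_quot_0: "fib_quot k 0 = 1 + fib_root k"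
  by (simp add: fib_quot_def)

lemma fib_quot_gt_1: "k \<ge> 1 \<Longrightarrow> fib_quot k m > 1"
proof (induction m)
  case 0
  then show ?case using fib_root_gt_1[of k] by (simp add: fib_quot_0)
qed (simp add: fib_quot_Suc)

text \<open>Closes the period: w^2 F_2k = F_(2k+2) says that a 2 followed by this quotient is again
  2 + (w - 1) = 1 + w.\<close>

lemma fib_quot_period:
  assumes "k \<ge> 1"
  shows "fib_quot k (2 * k - 1) = 1 / (fib_root k - 1)"
proof -
  obtain m where m: "2 * k = Suc m" using assms by (cases "2 * k") auto
  have w: "fib_root k > 1" by (rule fib_root_gt_1[OF assms])
  have "(real (fib (Suc m)) * fib_root k + real (fib (Suc (Suc m)))) * (fib_root k - 1)
      = real (fib m) * fib_root k + real (fib (Suc m))"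
    using fib_root_sq[OF assms] unfolding m by (simp add: algebra_simps power2_eq_square)
  then show ?thesis using w fib_quot_denom_pos[OF assms, of m] m
    unfolding fib_quot_def by (simp add: field_simps)
qed

text \<open>The parameter j is the phase. The difference is taken in \<open>int\<close> to avoid
  truncation for n > j; its residue counts the places up to the next 2, so it also serves as the
  index of \<open>fib_quot\<close> in \<open>per_quot\<close>.\<close>

definition per_word :: "nat \<Rightarrow> nat \<Rightarrow> nat \<Rightarrow> int" where
  "per_word k j n = (if (int j - int n) mod int (2 * k) = 0 then 2 else 1)"

definition per_quot :: "nat \<Rightarrow> nat \<Rightarrow> nat \<Rightarrow> real" where
  "per_quot k j n = fib_quot k (nat ((int j - int n) mod int (2 * k)))"

lemma complete_quotients_per_word:
  assumes "k \<ge> 1"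
  shows "complete_quotients (per_word k j) (per_quot k j)"
proof
  fix n
  define m where "m = (int j - int n) mod int (2 * k)"
  have m: "0 \<le> m" "m < int (2 * k)" using assms by (auto simp: m_def)
  have "(int j - int (Suc n)) mod int (2 * k) = (m - 1) mod int (2 * k)"
    unfolding m_def mod_diff_left_eq by (simp add: algebra_simps)
  also have "\<dots> = (if m = 0 then int (2 * k) - 1 else m - 1)"
    using m assms by (auto simp: zmod_minus1 intro!: mod_pos_pos_trivial)
  finally have S: "(int j - int (Suc n)) mod int (2 * k) = (if m = 0 then int (2 * k) - 1 else m - 1)" .
  show "per_quot k j n = of_int (per_word k j n) + 1 / per_quot k j (Suc n)"
  proof (cases "m = 0")
    case True
    have "nat (int (2 * k) - 1) = 2 * k - 1" by (simp add: nat_diff_distrib)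
    then show ?thesis using S True fib_quot_period[OF assms] fib_quot_0[of k]
      unfolding per_quot_def per_word_def m_def by simp
  next
    case False
    then have "nat m = Suc (nat (m - 1))" using m by simp
    then show ?thesis using S False fib_quot_Suc[OF assms]
      unfolding per_quot_def per_word_def m_def by simp
  qed
qed (auto simp: per_word_def per_quot_def fib_quot_gt_1[OF assms])

text \<open>The beta numbers have integer part 0, which \<open>per_word\<close> never takes; only
  index 0 is free of the positivity conditions.\<close>

lemma complete_quotients_head:
  assumes "complete_quotients a X"
  shows "complete_quotients (a(0 := c)) (X(0 := of_int c + 1 / X 1))"
proof -
  interpret complete_quotients a X by fact
  show ?thesis
  proof
    show "(X(0 := of_int c + 1 / X 1)) n = of_int ((a(0 := c)) n) + 1 / (X(0 := of_int c + 1 / X 1)) (Suc n)" for n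
      using cq_rec[of n] by simp
  qed (auto intro: quot_ge_1 cq_gt_1)
qed

lemma alpha_word:
  assumes "k \<ge> 1"
  shows "((replicate (2 * k - 1) 1 @ [2])\<^sup>\<omega>) = per_word k (2 * k - 1)"
proof
  fix n
  define r where "r = n mod (2 * k)"
  have r: "r < 2 * k" using assms by (simp add: r_def)
  have "(int (2 * k - 1) - int n) mod int (2 * k) = (int (2 * k - 1) - int r) mod int (2 * k)"
    unfolding r_def by (simp add: zmod_int mod_diff_right_eq)
  also have "\<dots> = int (2 * k - 1) - int r"
    using r by (intro mod_pos_pos_trivial) auto
  finally have e: "(int (2 * k - 1) - int n) mod int (2 * k) = 0 \<longleftrightarrow> r = 2 * k - 1" using r by auto
  have "((replicate (2 * k - 1) 1 @ [2])\<^sup>\<omega>) n = (replicate (2 * k - 1) 1 @ [2::int]) ! r"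
    unfolding iter_def r_def using assms by simp
  also have "\<dots> = per_word k (2 * k - 1) n"
    unfolding per_word_def e using r by (auto simp: nth_append)
  finally show "((replicate (2 * k - 1) 1 @ [2])\<^sup>\<omega>) n = per_word k (2 * k - 1) n" .
qed

lemma beta_word:
  assumes "k \<ge> 1" "Suc m < 2 * k"
  shows "(0 # replicate m 1) \<frown> (2 # replicate (2 * k - 1) 1)\<^sup>\<omega> = (per_word k (Suc m))(0 := 0)"
proof
  fix n
  consider "n = 0" | "0 < n" "n \<le> m" | "n \<ge> Suc m" by linarith
  then show "((0 # replicate m 1) \<frown> (2 # replicate (2 * k - 1) 1)\<^sup>\<omega>) n = ((per_word k (Suc m))(0 := 0)) n"
  proof cases
    case 2
    then have "(int (Suc m) - int n) mod int (2 * k) = int (Suc m) - int n"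
      using assms by (intro mod_pos_pos_trivial) auto
    then show ?thesis using 2 by (auto simp: conc_def per_word_def nth_Cons')
  next
    case 3
    define r where "r = (n - Suc m) mod (2 * k)"
    have r: "r < 2 * k" using assms by (simp add: r_def)
    have "(int (Suc m) - int n) mod int (2 * k) = 0 \<longleftrightarrow> int (2 * k) dvd int (Suc m) - int n"
      by (simp add: mod_eq_0_iff_dvd)
    also have "\<dots> \<longleftrightarrow> int (2 * k) dvd int (n - Suc m)"
      using 3 by (subst dvd_diff_commute) (simp add: of_nat_diff)
    also have "\<dots> \<longleftrightarrow> r = 0"
      unfolding int_dvd_int_iff r_def by (simp add: mod_eq_0_iff_dvd)
    finally have e: "(int (Suc m) - int n) mod int (2 * k) = 0 \<longleftrightarrow> r = 0" .
    have "((0 # replicate m 1) \<frown> (2 # replicate (2 * k - 1) 1)\<^sup>\<omega>) n = (2 # replicate (2 * k - 1) (1::int)) ! r"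
      using 3 assms unfolding conc_def iter_def r_def by simp
    also have "\<dots> = ((per_word k (Suc m))(0 := 0)) n"
      unfolding per_word_def using e 3 r by (auto simp: nth_Cons')
    finally show ?thesis .
  qed (simp add: conc_def)
qed

lemma alpha_eq:
  assumes "k \<ge> 1"
  shows "alpha k = 1 / (fib_root k - 1)"
proof -
  have "alpha k = per_quot k (2 * k - 1) 0"
    using assms cf_value_eq[OF complete_quotients_per_word[OF assms]] alpha_word[OF assms]
    by (simp add: alpha_def)
  moreover have "(int (2 * k - 1) - int 0) mod int (2 * k) = int (2 * k - 1) - int 0"
    using assms by (intro mod_pos_pos_trivial) auto
  then have "per_quot k (2 * k - 1) 0 = fib_quot k (2 * k - 1)"
    by (simp add: per_quot_def nat_diff_distrib)
  ultimately show ?thesis using fib_quot_period[OF assms] by simp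
qed

lemma beta_value:
  assumes "k \<ge> 1" "Suc m < 2 * k"
  shows "cf_value ((0 # replicate m 1) \<frown> (2 # replicate (2 * k - 1) 1)\<^sup>\<omega>) = 1 / fib_quot k m"
  unfolding beta_word[OF assms]
  using cf_value_eq[OF complete_quotients_head[OF complete_quotients_per_word[OF assms(1)]]] assms
  by (simp add: per_quot_def)

lemma Dk_eq:
  assumes "k \<ge> 1"
  shows "Dk k = (1 + fib_root k) / (2 * fib_root k)"
  using fib_root_gt_1[OF assms] unfolding Dk_def alpha_eq[OF assms] by (simp add: field_simps)

section \<open>Closed form of f_k in terms of Fibonacci numbers\<close>

lemma real_fib_double:
  "real (fib (2 * k)) = real (fib k) * (2 * real (fib (Suc k)) - real (fib k))"
  "real (fib (Suc (Suc (2 * k)))) = real (fib (Suc k)) * (2 * real (fib k) + real (fib (Suc k)))"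
proof -
  show A: "real (fib (2 * k)) = real (fib k) * (2 * real (fib (Suc k)) - real (fib k))"
    using arg_cong[OF fib_double(1)[of k], of real_of_int] by simp
  have "real (fib (Suc (2 * k))) = (real (fib k))\<^sup>2 + (real (fib (Suc k)))\<^sup>2"
    using arg_cong[OF fib_double(2)[of k], of real_of_int] by simp
  then show "real (fib (Suc (Suc (2 * k)))) = real (fib (Suc k)) * (2 * real (fib k) + real (fib (Suc k)))"
    using A by (simp add: power2_eq_square algebra_simps)
qed

text \<open>With f, g, e = F_k, F_(k+1), F_(k-1) the inner fraction is \<open>beta k\<close> and the
  right-hand side is \<open>fib_gap k\<close> / F_(2k+2). After clearing denominators only the
  quadratic equation of w is used.\<close>

lemma beta_identity_odd:
  fixes f g w :: real
  assumes "f > 0" "g > 0" "w > 0" "w\<^sup>2 * (f * (2 * g - f)) = g * (2 * f + g)" "e = g - f" "e \<ge> 0"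
  shows "2 / ((2 * ((e * w + f) / (f * w + g)) + 1) * w) = 2 * f * g / (g * (2 * f + g))"
proof -
  have p: "f * w + g > 0" using assms by (simp add: add_pos_pos)
  have n: "2 * (e * w + f) + (f * w + g) > 0" using assms by (simp add: add_pos_pos add_nonneg_pos)
  have b: "2 * ((e * w + f) / (f * w + g)) + 1 = (2 * (e * w + f) + (f * w + g)) / (f * w + g)"
    using p by (simp add: field_simps)
  have "(f * w + g) * (2 * f + g) = f * ((2 * (e * w + f) + (f * w + g)) * w)"
    using assms(4,5) by algebra
  then have "(2 * (f * w + g)) * (g * (2 * f + g))
      = (2 * f * g) * ((2 * (e * w + f) + (f * w + g)) * w)"
    by algebra
  moreover have "(2 * (e * w + f) + (f * w + g)) * w \<noteq> 0" "g * (2 * f + g) \<noteq> 0"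
    using n assms by auto
  ultimately show ?thesis unfolding b using p by (simp add: frac_eq_eq)
qed

text \<open>The two fractions are \<open>beta1 k\<close> and \<open>beta2 k\<close>, with d =
  F_(k-2). The Cassini relation for even k produces the additional 1 of
  \<open>fib_gap\<close>.\<close>

lemma beta_identity_even:
  fixes f g w :: real
  assumes "f > 0" "g > 0" "w > 0" "w\<^sup>2 * (f * (2 * g - f)) = g * (2 * f + g)"
    "e = g - f" "d = f - e" "e > 0" "d \<ge> 0" "g\<^sup>2 - g * f - f\<^sup>2 = 1"
  shows "2 / (((f * w + g) / (g * w + (f + g)) + (d * w + e) / (e * w + f) + 1) * w)
    = (2 * f * g + 1) / (g * (2 * f + g))"
proof -
  define p q where "p = g * w + (f + g)" and "q = e * w + f"
  define s where "s = (f * w + g) * q + (d * w + e) * p + p * q"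
  have p: "p > 0" "q > 0" using assms by (auto simp: p_def q_def add_pos_pos)
  then have s: "s > 0" unfolding s_def using assms by (auto intro!: add_nonneg_pos)
  have b: "(f * w + g) / p + (d * w + e) / q + 1 = s / (p * q)"
    using p unfolding s_def by (simp add: add_divide_distrib)
  have "2 * (p * q) * (g * (2 * f + g)) = (2 * f * g + 1) * (s * w)"
    using assms(4,5,6,9) unfolding p_def q_def s_def by algebra
  moreover have "s * w \<noteq> 0" "g * (2 * f + g) \<noteq> 0" using s assms by auto
  ultimately show ?thesis unfolding p_def[symmetric] q_def[symmetric] b using p
    by (simp add: frac_eq_eq)
qed

text \<open>Since alpha_k + 1 = w alpha_k, the fraction under the root is 2/(b w x^2), where b is 2
  beta_k + 1 or beta_k^(1) + beta_k^(2) + 1; the two preceding identities evaluate it.\<close>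

lemma fk_eq:
  assumes "k \<ge> 1"
  shows "fk k x = 2 * Dk k /
    (1 + sqrt (1 - real_of_int (fib_gap k) / (real (fib (Suc (Suc (2 * k)))) * x\<^sup>2)))"
proof -
  define w where "w = fib_root k"
  define C where "C = real (fib (Suc (Suc (2 * k))))"
  define f g where "f = real (fib k)" and "g = real (fib (Suc k))"
  have w: "w > 1" using fib_root_gt_1[OF assms] by (simp add: w_def)
  have fg: "f > 0" "g > 0" using fib_neq_0_nat[of k] fib_neq_0_nat[of "Suc k"] assms
    by (auto simp: f_def g_def)
  have C: "C = g * (2 * f + g)" unfolding C_def f_def g_def by (rule real_fib_double)
  have w2: "w\<^sup>2 * (f * (2 * g - f)) = g * (2 * f + g)"
    using fib_root_sq[OF assms] unfolding real_fib_double w_def f_def g_def .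
  have al: "2 * alpha k / (b * (alpha k + 1) * x\<^sup>2) = 2 / (b * w) / x\<^sup>2" for b
  proof -
    have "alpha k + 1 = w * alpha k" "alpha k > 0"
      using w unfolding alpha_eq[OF assms] w_def[symmetric] by (auto simp: field_simps)
    then show ?thesis by simp
  qed
  obtain m where m: "k = Suc m" using assms by (cases k) auto
  show ?thesis
  proof (cases "odd k")
    case True
    have "beta k = 1 / fib_quot k m" unfolding beta_def using beta_value[OF assms, of m] m by simp
    also have "\<dots> = (real (fib m) * w + f) / (f * w + g)"
      unfolding fib_quot_def f_def g_def w_def m by simp
    finally have b: "beta k = (real (fib m) * w + f) / (f * w + g)" .
    have "real (fib m) = g - f" by (simp add: f_def g_def m)
    then have "2 / ((2 * beta k + 1) * w) = 2 * f * g / (g * (2 * f + g))"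
      unfolding b using fg w w2 by (intro beta_identity_odd) auto
    also have "\<dots> = real_of_int (fib_gap k) / C"
      using True unfolding C fib_gap_def f_def g_def by simp
    finally show ?thesis using True unfolding fk_def al C_def[symmetric] by simp
  next
    case False
    then obtain n where n: "m = Suc n" using m by (cases m) auto
    have "beta1 k = 1 / fib_quot k k"
      unfolding beta1_def using beta_value[OF assms, of k] m n by simp
    also have "\<dots> = (f * w + g) / (g * w + (f + g))"
      unfolding fib_quot_def f_def g_def w_def by simp
    finally have b1: "beta1 k = (f * w + g) / (g * w + (f + g))" .
    have "beta2 k = 1 / fib_quot k n"
      unfolding beta2_def using beta_value[OF assms, of n] m n by simp
    also have "\<dots> = (real (fib n) * w + real (fib m)) / (real (fib m) * w + f)"
      unfolding fib_quot_def f_def w_def m n by simp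
    finally have b2: "beta2 k = (real (fib n) * w + real (fib m)) / (real (fib m) * w + f)" .
    have "real_of_int ((int (fib (Suc k)))\<^sup>2 - int (fib (Suc k)) * int (fib k) - (int (fib k))\<^sup>2) = 1"
      unfolding fib_Suc_sq using False by simp
    then have "g\<^sup>2 - g * f - f\<^sup>2 = 1" unfolding f_def g_def by simp
    moreover have "fib m > 0" using n by (intro fib_neq_0_nat) simp
    moreover have "real (fib m) = g - f" "real (fib n) = f - real (fib m)"
      by (auto simp: f_def g_def m n)
    ultimately have "2 / ((beta1 k + beta2 k + 1) * w) = (2 * f * g + 1) / (g * (2 * f + g))"
      unfolding b1 b2 using fg w w2 by (intro beta_identity_even) auto
    also have "\<dots> = real_of_int (fib_gap k) / C"
      using False unfolding C fib_gap_def f_def g_def by simp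
    finally show ?thesis using False unfolding fk_def al C_def[symmetric] by simp
  qed
qed

section \<open>Values next to a partial quotient 2\<close>

lemma Dk_pos: "k \<ge> 1 \<Longrightarrow> Dk k > 0"
  using fib_root_gt_1[of k] by (simp add: Dk_eq)

lemma fk_sqrt_bounds:
  assumes "k \<ge> 1" "x \<ge> 1"
  shows "0 \<le> 1 - real_of_int (fib_gap k) / (real (fib (Suc (Suc (2 * k)))) * x\<^sup>2)"
    "real_of_int (fib_gap k) / (real (fib (Suc (Suc (2 * k)))) * x\<^sup>2) > 0"
proof -
  have "real_of_int (fib_gap k) \<le> real (fib (Suc (2 * k)))"
    using fib_gap_le[OF assms(1)] by linarith
  also have "\<dots> \<le> real (fib (Suc (Suc (2 * k))))" by simp
  also have "\<dots> \<le> real (fib (Suc (Suc (2 * k)))) * x\<^sup>2"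
    using mult_left_mono[of 1 "x\<^sup>2"] assms(2) by simp
  finally have c: "real_of_int (fib_gap k) \<le> real (fib (Suc (Suc (2 * k)))) * x\<^sup>2" .
  moreover have "real (fib (Suc (Suc (2 * k)))) * x\<^sup>2 > 0"
    using fib_Suc_pos[of "Suc (2 * k)"] assms(2) by (intro mult_pos_pos) (simp_all del: fib.simps)
  ultimately show "0 \<le> 1 - real_of_int (fib_gap k) / (real (fib (Suc (Suc (2 * k)))) * x\<^sup>2)"
    "real_of_int (fib_gap k) / (real (fib (Suc (Suc (2 * k)))) * x\<^sup>2) > 0"
    using fib_gap_pos[OF assms(1)] by (simp_all only: diff_ge_0_iff_ge divide_le_eq_1_pos zero_less_divide_iff) auto
qed

lemma fk_gt_Dk:
  assumes "k \<ge> 1" "x \<ge> 1"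
  shows "fk k x > Dk k"
proof -
  define h where "h = 1 - real_of_int (fib_gap k) / (real (fib (Suc (Suc (2 * k)))) * x\<^sup>2)"
  have h: "0 \<le> h" "h < 1" using fk_sqrt_bounds[OF assms] by (auto simp: h_def)
  have "sqrt h < 1" "sqrt h \<ge> 0" using h by auto
  then have "Dk k * (1 + sqrt h) < 2 * Dk k" using Dk_pos[OF assms(1)] by simp
  then show ?thesis unfolding fk_eq[OF assms(1)] h_def[symmetric]
    using \<open>sqrt h \<ge> 0\<close> by (subst pos_less_divide_eq) (auto intro: add_pos_nonneg)
qed

text \<open>Between denominators, t psi(t) is bounded by a value belonging to the right end of the
  interval; monotonicity moves the bound from that end back to t.\<close>

lemma fk_strict_decreasing:
  assumes "k \<ge> 1" "1 \<le> x" "x < y"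
  shows "fk k y < fk k x"
proof -
  define C where "C = real (fib (Suc (Suc (2 * k))))"
  define c where "c = real_of_int (fib_gap k)"
  have C: "C > 0" unfolding C_def using fib_Suc_pos[of "Suc (2 * k)"] by linarith
  have c: "c > 0" unfolding c_def using fib_gap_pos[OF assms(1)] by simp
  have "C * x\<^sup>2 < C * y\<^sup>2" "C * x\<^sup>2 > 0" using C assms by (auto intro!: power_strict_mono)
  then have "c / (C * y\<^sup>2) < c / (C * x\<^sup>2)" using c by (intro divide_strict_left_mono) auto
  then have "sqrt (1 - c / (C * x\<^sup>2)) < sqrt (1 - c / (C * y\<^sup>2))" by simp
  moreover have "sqrt (1 - c / (C * x\<^sup>2)) \<ge> 0"
    using fk_sqrt_bounds[of k x] assms unfolding C_def c_def by simp
  ultimately show ?thesis unfolding fk_eq[OF assms(1)] C_def[symmetric] c_def[symmetric]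
    using Dk_pos[OF assms(1)] by (intro divide_strict_left_mono) (auto intro!: mult_pos_pos add_pos_nonneg)
qed

lemma fk_tendsto:
  assumes "k \<ge> 1"
  shows "(fk k \<longlongrightarrow> Dk k) at_top"
proof -
  define C where "C = real (fib (Suc (Suc (2 * k))))"
  have C: "C > 0" unfolding C_def using fib_Suc_pos[of "Suc (2 * k)"] by linarith
  have "((\<lambda>x::real. real_of_int (fib_gap k) / (C * x\<^sup>2)) \<longlongrightarrow> 0) at_top"
    using C by (intro real_tendsto_divide_at_top[OF tendsto_const] filterlim_tendsto_pos_mult_at_top[OF tendsto_const]
        filterlim_pow_at_top filterlim_ident) auto
  then have "((\<lambda>x. 2 * Dk k / (1 + sqrt (1 - real_of_int (fib_gap k) / (C * x\<^sup>2)))) \<longlongrightarrow>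
      2 * Dk k / (1 + sqrt (1 - 0))) at_top"
    by (intro tendsto_intros) auto
  moreover have "fk k = (\<lambda>x. 2 * Dk k / (1 + sqrt (1 - real_of_int (fib_gap k) / (C * x\<^sup>2))))"
    using fk_eq[OF assms] unfolding C_def by blast
  ultimately show ?thesis by simp
qed

lemma isCont_fk:
  assumes "k \<ge> 1" "x \<ge> 1"
  shows "isCont (fk k) x"
proof -
  define C where "C = real (fib (Suc (Suc (2 * k))))"
  have C: "C > 0" unfolding C_def using fib_Suc_pos[of "Suc (2 * k)"] by linarith
  have "0 \<le> 1 - real_of_int (fib_gap k) / (C * x\<^sup>2)"
    using fk_sqrt_bounds[OF assms] unfolding C_def by simp
  then have "sqrt (1 - real_of_int (fib_gap k) / (C * x\<^sup>2)) \<ge> 0" by (rule real_sqrt_ge_zero)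
  then have "1 + sqrt (1 - real_of_int (fib_gap k) / (C * x\<^sup>2)) \<noteq> 0" by linarith
  then have "isCont (\<lambda>x. 2 * Dk k / (1 + sqrt (1 - real_of_int (fib_gap k) / (C * x\<^sup>2)))) x"
    using C assms by (intro continuous_intros) auto
  moreover have "fk k = (\<lambda>x. 2 * Dk k / (1 + sqrt (1 - real_of_int (fib_gap k) / (C * x\<^sup>2))))"
    using fk_eq[OF assms(1)] unfolding C_def by blast
  ultimately show ?thesis by simp
qed

text \<open>The radicand is the perfect square (x/(wy))^2, so both sides are rational in w, x and
  y.\<close>

lemma value_before_two:
  fixes A C w x y :: real
  assumes "A > 0" "w > 0" "x > 0" "y > 0" "w\<^sup>2 * A = C"
  shows "1 / (1 + ((x - y) / y) / (1 + w))
    = 2 * ((1 + w) / (2 * w)) / (1 + sqrt (1 + (A * x\<^sup>2 - C * y\<^sup>2) / (C * y\<^sup>2)))"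
proof -
  have "1 + (A * x\<^sup>2 - C * y\<^sup>2) / (C * y\<^sup>2) = (x / (w * y))\<^sup>2"
    using assms(1-4) unfolding assms(5)[symmetric] by (simp add: field_simps)
  then have s: "sqrt (1 + (A * x\<^sup>2 - C * y\<^sup>2) / (C * y\<^sup>2)) = x / (w * y)"
    using assms by simp
  define N where "N = x + w * y"
  have "N > 0" using assms by (simp add: N_def add_pos_pos)
  have "1 + ((x - y) / y) / (1 + w) = N / (y * (1 + w))"
    using assms unfolding N_def by (simp add: divide_simps) (simp add: algebra_simps)
  moreover have "1 + x / (w * y) = N / (w * y)" using assms by (simp add: N_def field_simps)
  moreover have "1 / (N / (y * (1 + w))) = 2 * ((1 + w) / (2 * w)) / (N / (w * y))"
    using \<open>N > 0\<close> assms by (simp add: divide_simps)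
  ultimately show ?thesis unfolding s by simp
qed

text \<open>The same x and y; x + y is the next denominator because the partial quotient is 2. The
  factor B arises from w^2 - 1 = B/A.\<close>

lemma value_after_two:
  fixes A B C w x y :: real
  assumes "A > 0" "w > 1" "x > 0" "y > 0" "w\<^sup>2 * A = C" "C = A + B"
  defines "S \<equiv> (x + w\<^sup>2 * y) / (w * (x + y))"
  shows "1 / (1 + (y / (x + y)) * (w - 1)) = 2 * ((1 + w) / (2 * w)) / (1 + S)"
    "S > 0" "1 - S\<^sup>2 = B * (A * x\<^sup>2 - C * y\<^sup>2) / (A * C * (x + y)\<^sup>2)"
proof -
  have p: "x + y > 0" "w * (x + y) > 0" "x + w * y > 0" using assms by (auto simp: add_pos_pos)
  have e1: "1 + (y / (x + y)) * (w - 1) = (x + w * y) / (x + y)"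
    using p by (simp add: field_simps)
  have e2: "1 + S = (1 + w) * (x + w * y) / (w * (x + y))"
    using p assms(2) unfolding S_def by (simp add: divide_simps) (simp add: power2_eq_square algebra_simps)
  have e3: "1 / (M / N) = 2 * ((1 + w) / (2 * w)) / ((1 + w) * M / (w * N))"
    if "M > 0" "N > 0" for M N :: real
    using that assms(2) by (simp add: divide_simps)
  show "1 / (1 + (y / (x + y)) * (w - 1)) = 2 * ((1 + w) / (2 * w)) / (1 + S)"
    unfolding e1 e2 using p by (intro e3)
  show "S > 0" unfolding S_def using assms by (auto intro!: divide_pos_pos add_pos_pos mult_pos_pos)
  have "1 - S\<^sup>2 = ((w * (x + y))\<^sup>2 - (x + w\<^sup>2 * y)\<^sup>2) / (w * (x + y))\<^sup>2"
    using p assms(2) unfolding S_def by (simp add: power_divide diff_divide_distrib)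
  also have "\<dots> = (w\<^sup>2 - 1) * (x\<^sup>2 - w\<^sup>2 * y\<^sup>2) / (w * (x + y))\<^sup>2"
    by (rule arg_cong[of _ _ "\<lambda>z. z / _"]) algebra
  also have "\<dots> = B * (A * x\<^sup>2 - C * y\<^sup>2) / (A * C * (x + y)\<^sup>2)"
  proof -
    have "((w\<^sup>2 - 1) * (x\<^sup>2 - w\<^sup>2 * y\<^sup>2)) * (A * C * (x + y)\<^sup>2)
        = (B * (A * x\<^sup>2 - C * y\<^sup>2)) * (w * (x + y))\<^sup>2"
      using assms(5,6) by algebra
    moreover have "C > 0" using assms(1,2) unfolding assms(5)[symmetric] by simp
    ultimately show ?thesis using p assms(1) by (subst frac_eq_eq) auto
  qed
  finally show "1 - S\<^sup>2 = B * (A * x\<^sup>2 - C * y\<^sup>2) / (A * C * (x + y)\<^sup>2)" .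
qed

context complete_quotients
begin

text \<open>For n >= 1, x / y = 1 + \<open>ratio (n - 1)\<close>. So at a 2 with complete quotient 1
  + w the sign compares the left tail \<open>ratio (n - 1)\<close> with the right tail w -
  1.\<close>

definition form_at :: "nat \<Rightarrow> nat \<Rightarrow> int" where
  "form_at k n = fib_form k (Q (n - 1) + Q n) (Q n)"

context
  fixes k m :: nat
  assumes k: "k \<ge> 1" and two: "a (Suc m) = 2" and root: "X (Suc m) = 1 + fib_root k"
begin

lemma value_at_two_before:
  "1 / (1 + v m) = 2 * Dk k / (1 + sqrt (1 + real_of_int (form_at k (Suc m))
     / (real (fib (Suc (Suc (2 * k)))) * (of_int (Q (Suc m)))\<^sup>2)))"
proof -
  define x y where "x = real_of_int (Q m + Q (Suc m))" and "y = real_of_int (Q (Suc m))"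
  have y: "y > 0" using Q_Suc_pos[of m] by (simp add: y_def)
  have x: "x > 0" using Q_Suc_pos[of m] Q_nonneg[of m] by (simp add: x_def)
  have A: "real (fib (2 * k)) > 0" using fib_even_pos[OF k] by simp
  have w: "fib_root k > 0" using fib_root_gt_1[OF k] by simp
  have "v m = ((x - y) / y) / (1 + fib_root k)"
    unfolding v_def ratio_def root x_def y_def by simp
  then have "1 / (1 + v m) = 2 * ((1 + fib_root k) / (2 * fib_root k)) / (1 + sqrt (1 +
     (real (fib (2 * k)) * x\<^sup>2 - real (fib (Suc (Suc (2 * k)))) * y\<^sup>2) / (real (fib (Suc (Suc (2 * k)))) * y\<^sup>2)))"
    using value_before_two[OF A w x y fib_root_sq[OF k]] by simp
  moreover have "real_of_int (form_at k (Suc m)) = real (fib (2 * k)) * x\<^sup>2 - real (fib (Suc (Suc (2 * k)))) * y\<^sup>2"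
    unfolding form_at_def fib_form_def x_def y_def by simp
  ultimately show ?thesis unfolding y_def Dk_eq[OF k] by simp
qed

lemma value_at_two_after:
  obtains S where "1 / (1 + v (Suc m)) = 2 * Dk k / (1 + S)" "S > 0"
    "1 - S\<^sup>2 = real (fib (Suc (2 * k))) * real_of_int (form_at k (Suc m))
      / (real (fib (2 * k)) * real (fib (Suc (Suc (2 * k)))) * (of_int (Q (Suc (Suc m))))\<^sup>2)"
proof -
  define x y where "x = real_of_int (Q m + Q (Suc m))" and "y = real_of_int (Q (Suc m))"
  have y: "y > 0" using Q_Suc_pos[of m] by (simp add: y_def)
  have x: "x > 0" using Q_Suc_pos[of m] Q_nonneg[of m] by (simp add: x_def)
  have A: "real (fib (2 * k)) > 0" using fib_even_pos[OF k] by simp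
  have w: "fib_root k > 1" using fib_root_gt_1[OF k] by simp
  have C: "real (fib (Suc (Suc (2 * k)))) = real (fib (2 * k)) + real (fib (Suc (2 * k)))" by simp
  have "1 / X (Suc (Suc m)) = fib_root k - 1" using cq_rec[of "Suc m"] two root by simp
  moreover have xy: "x + y = real_of_int (Q (Suc (Suc m)))"
    unfolding x_def y_def using two by simp
  ultimately have v: "v (Suc m) = (y / (x + y)) * (fib_root k - 1)"
    unfolding v_def ratio_def xy y_def by (simp add: divide_inverse)
  have f: "real_of_int (form_at k (Suc m)) = real (fib (2 * k)) * x\<^sup>2 - real (fib (Suc (Suc (2 * k)))) * y\<^sup>2"
    unfolding form_at_def fib_form_def x_def y_def by simp
  show ?thesis
    by (rule that) (use value_after_two[OF A w x y fib_root_sq[OF k] C]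
      in \<open>simp_all only: v f xy[symmetric] Dk_eq[OF k]\<close>)
qed

text \<open>By \<open>fib_form_gap\<close>, G <= -c or G >= A. The first case settles the value
  before the 2. In the second, 1 - S^2 = BG/(A C t^2) >= B/(C t^2) >= c/(C t^2) settles the value
  after it.\<close>

lemma fk_le_next_to_two:
  "fk k (of_int (Q (Suc m))) \<le> 1 / (1 + v m)
   \<or> fk k (of_int (Q (Suc (Suc m)))) \<le> 1 / (1 + v (Suc m))"
proof -
  define A B C where "A = real (fib (2 * k))" and "B = real (fib (Suc (2 * k)))"
    and "C = real (fib (Suc (Suc (2 * k))))"
  define c G where "c = real_of_int (fib_gap k)" and "G = real_of_int (form_at k (Suc m))"
  have pos: "A > 0" "B > 0" "C > 0"
    using fib_even_pos[OF k] fib_Suc_pos[of "2 * k"] fib_Suc_pos[of "Suc (2 * k)"]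
    unfolding A_def B_def C_def by linarith+
  have D: "2 * Dk k \<ge> 0" using Dk_pos[OF k] by simp
  have "form_at k (Suc m) \<le> - fib_gap k \<or> form_at k (Suc m) \<ge> int (fib (2 * k))"
    unfolding form_at_def
    by (rule fib_form_gap[OF k]) (use Q_Suc_pos[of m] Q_nonneg[of m] in auto)
  then show ?thesis
  proof
    assume "form_at k (Suc m) \<le> - fib_gap k"
    then have G: "G \<le> - c" unfolding G_def c_def by linarith
    define y where "y = real_of_int (Q (Suc m))"
    have y: "y > 0" using Q_Suc_pos[of m] by (simp add: y_def)
    have "1 + G / (C * y\<^sup>2) \<le> 1 - c / (C * y\<^sup>2)"
      using divide_right_mono[OF G, of "C * y\<^sup>2"] pos by simp
    moreover have nonneg: "1 - c / (C * y\<^sup>2) \<ge> 0"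
      using fk_sqrt_bounds[OF k, of y] Q_Suc_pos[of m] unfolding c_def C_def y_def by simp
    moreover have e: "1 + G / (C * y\<^sup>2) = A * (real_of_int (Q m + Q (Suc m)))\<^sup>2 / (C * y\<^sup>2)"
      using y pos unfolding G_def form_at_def fib_form_def A_def C_def y_def
      by (simp add: field_simps del: fib.simps)
    ultimately have "2 * Dk k / (1 + sqrt (1 - c / (C * y\<^sup>2))) \<le> 2 * Dk k / (1 + sqrt (1 + G / (C * y\<^sup>2)))"
      using pos y nonneg by (intro divide_left_mono[OF _ D] mult_pos_pos add_pos_nonneg add_left_mono) (auto simp: e)
    then show ?thesis
      unfolding fk_eq[OF k] value_at_two_before C_def c_def G_def y_def by simp
  next
    assume "form_at k (Suc m) \<ge> int (fib (2 * k))"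
    then have G: "G \<ge> A" unfolding G_def A_def by linarith
    obtain S where S: "1 / (1 + v (Suc m)) = 2 * Dk k / (1 + S)" "S > 0"
      "1 - S\<^sup>2 = B * G / (A * C * (of_int (Q (Suc (Suc m))))\<^sup>2)"
      unfolding A_def B_def C_def G_def by (rule value_at_two_after)
    define t where "t = real_of_int (Q (Suc (Suc m)))"
    have t: "t > 0" using Q_Suc_pos[of "Suc m"] by (simp add: t_def del: cf_den.simps)
    have "c \<le> B" using fib_gap_le[OF k] unfolding c_def B_def by linarith
    then have "c / (C * t\<^sup>2) \<le> B / (C * t\<^sup>2)" using pos t by (intro divide_right_mono) auto
    also have "\<dots> = B * A / (A * C * t\<^sup>2)" using pos by simp
    also have "\<dots> \<le> B * G / (A * C * t\<^sup>2)"
      using pos G by (intro divide_right_mono mult_left_mono) auto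
    finally have "S\<^sup>2 \<le> 1 - c / (C * t\<^sup>2)" using S(3) unfolding t_def[symmetric] by linarith
    then have "S \<le> sqrt (1 - c / (C * t\<^sup>2))" by (rule real_le_rsqrt)
    then have "2 * Dk k / (1 + sqrt (1 - c / (C * t\<^sup>2))) \<le> 2 * Dk k / (1 + S)"
      using S(2) by (intro divide_left_mono[OF _ D] mult_pos_pos) auto
    then show ?thesis unfolding fk_eq[OF k] S(1) C_def c_def t_def by simp
  qed
qed

lemma value_at_two_before_extremal:
  assumes "form_at k (Suc m) = - fib_gap k"
  shows "1 / (1 + v m) = fk k (of_int (Q (Suc m)))"
  unfolding value_at_two_before fk_eq[OF k] assms by simp

lemma value_at_two_after_extremal:
  assumes "form_at k (Suc m) = - fib_gap k"
  shows "1 / (1 + v (Suc m)) < Dk k"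
proof -
  obtain S where S: "1 / (1 + v (Suc m)) = 2 * Dk k / (1 + S)" "S > 0"
    "1 - S\<^sup>2 = real (fib (Suc (2 * k))) * real_of_int (form_at k (Suc m))
      / (real (fib (2 * k)) * real (fib (Suc (Suc (2 * k)))) * (of_int (Q (Suc (Suc m))))\<^sup>2)"
    by (rule value_at_two_after)
  have "real (fib (2 * k)) * real (fib (Suc (Suc (2 * k)))) * (of_int (Q (Suc (Suc m))))\<^sup>2 > 0"
    using fib_even_pos[OF k] fib_Suc_pos[of "Suc (2 * k)"] Q_Suc_pos[of "Suc m"]
    by (intro mult_pos_pos) (auto simp del: cf_den.simps fib.simps)
  moreover have "real (fib (Suc (2 * k))) * real_of_int (form_at k (Suc m)) < 0"
    unfolding assms using fib_gap_pos[OF k] fib_Suc_pos[of "2 * k"]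
    by (intro mult_pos_neg) (auto simp del: fib.simps)
  ultimately have "1 - S\<^sup>2 < 0" unfolding S(3) by (rule divide_neg_pos[rotated])
  then have "S > 1" using S(2) by (simp add: power2_eq_square) (smt (verit) mult_le_one)
  then show ?thesis unfolding S(1) using Dk_pos[OF k] by (simp add: pos_divide_less_eq)
qed

end

text \<open>The left tail is at least 1/2 and the complete quotient at most 2, so v >= 1/4 and the
  value is at most 4/5.\<close>

lemma value_between_ones:
  assumes "k \<ge> 2" "a (Suc n) = 1" "a (Suc (Suc n)) = 1"
  shows "1 / (1 + v (Suc n)) < Dk k"
proof -
  have w: "0 < fib_root k" "fib_root k < 5 / 3"
    using fib_root_gt_1[of k] fib_root_less[of k] assms by auto
  have r: "ratio (Suc n) \<ge> 1 / 2" unfolding ratio_Suc using ratio_bounds[of n] assms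
    by (simp add: divide_simps)
  have "X (Suc (Suc (Suc n))) > 1" by (rule cq_gt_1) simp
  then have X: "X (Suc (Suc n)) \<le> 2" using cq_rec[of "Suc (Suc n)"] assms by simp
  have X0: "X (Suc (Suc n)) > 0" using cq_gt_1[of "Suc (Suc n)"] by simp
  have "v (Suc n) \<ge> (1 / 2) / 2" unfolding v_def using r X X0 by (intro frac_le) auto
  then have "1 / (1 + v (Suc n)) \<le> 1 / (1 + (1 / 2) / 2)" by (intro divide_left_mono) auto
  also have "\<dots> < Dk k" using w assms by (simp add: Dk_eq divide_simps)
  finally show ?thesis .
qed

lemma Q_ones:
  assumes "\<And>i. 0 < i \<Longrightarrow> i \<le> l \<Longrightarrow> a (n + i) = 1"
  shows "Q (Suc n + l) = int (fib (Suc l)) * Q (Suc n) + int (fib l) * Q n"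
  using assms
proof (induction l rule: induct_nat_012)
  case 1
  then show ?case using 1[of 1] by simp
next
  case (ge2 l)
  have "Q (Suc n + Suc (Suc l)) = a (n + Suc (Suc l)) * Q (Suc n + Suc l) + Q (Suc n + l)" by simp
  also have "a (n + Suc (Suc l)) = 1" using ge2.prems[of "Suc (Suc l)"] by simp
  also have "Q (Suc n + Suc l) = int (fib (Suc (Suc l))) * Q (Suc n) + int (fib (Suc l)) * Q n"
    by (rule ge2.IH(2)) (use ge2.prems in auto)
  also have "Q (Suc n + l) = int (fib (Suc l)) * Q (Suc n) + int (fib l) * Q n"
    by (rule ge2.IH(1)) (use ge2.prems in auto)
  finally show ?case by (simp add: algebra_simps)
qed simp

text \<open>Going from one 2 through 2k - 1 ones to the next 2 maps (x, y) to (Bx + Cy, Ax +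
  By).\<close>

lemma form_at_period:
  assumes "k \<ge> 1" "n \<ge> 1" "a n = 2" "\<And>i. 0 < i \<Longrightarrow> i < 2 * k \<Longrightarrow> a (n + i) = 1"
  shows "form_at k (n + 2 * k) = form_at k n"
proof -
  obtain l where l: "2 * k = Suc (Suc l)" using assms(1) by (cases k) auto
  define x y where "x = Q (n - 1) + Q n" and "y = Q n"
  have S: "Q (Suc n) = x + y" using assms(2,3) by (cases n) (auto simp: x_def y_def)
  have "Q (Suc n + Suc l) = int (fib (Suc (Suc l))) * Q (Suc n) + int (fib (Suc l)) * Q n"
    by (rule Q_ones) (use assms(4) l in auto)
  moreover have "Q (Suc n + l) = int (fib (Suc l)) * Q (Suc n) + int (fib l) * Q n"
    by (rule Q_ones) (use assms(4) l in auto)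
  ultimately have
    "Q (n + 2 * k) = int (fib (2 * k)) * x + int (fib (Suc (2 * k))) * y"
    "Q (n + 2 * k - 1) + Q (n + 2 * k)
      = int (fib (Suc (2 * k))) * x + int (fib (Suc (Suc (2 * k)))) * y"
    unfolding l S y_def[symmetric] by (simp_all add: algebra_simps)
  then show ?thesis
    unfolding form_at_def x_def[symmetric] unfolding y_def[symmetric]
    by (simp only: fib_form_automorph)
qed

end

section \<open>The extremal numbers\<close>

lemma per_word_two_iff: "per_word k j n = 2 \<longleftrightarrow> int (2 * k) dvd int j - int n"
  by (simp add: per_word_def mod_eq_0_iff_dvd)

lemma per_word_one_iff: "per_word k j n = 1 \<longleftrightarrow> \<not> int (2 * k) dvd int j - int n"
  by (simp add: per_word_def mod_eq_0_iff_dvd)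

lemma per_word_periodic:
  assumes "0 < i" "i < 2 * k"
  shows "per_word k j (j + 2 * k * t) = 2" "per_word k j (j + 2 * k * t + i) = 1"
proof -
  show "per_word k j (j + 2 * k * t) = 2" unfolding per_word_two_iff by simp
  have "\<not> 2 * k dvd i" using assms by (intro nat_dvd_not_less)
  moreover have "int j - int (j + 2 * k * t + i) = int (2 * k) * (- int t) - int i" by simp
  ultimately show "per_word k j (j + 2 * k * t + i) = 1"
    unfolding per_word_one_iff by (metis dvd_diff_right_iff dvd_triv_left int_dvd_int_iff)
qed

text \<open>Covers all three beta numbers: m ones before the first 2 give the starting vector
  (F_(m+2), F_(m+1)), and periodicity keeps G = -c at every 2. Values before a 2 then equal f_k,
  while all later others are below D_k.\<close>

lemma extremal_number:
  fixes k m :: nat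
  assumes k: "k \<ge> 1" and m: "Suc m < 2 * k"
    and start: "fib_form k (int (fib (Suc (Suc m)))) (int (fib (Suc m))) = - fib_gap k"
  defines "\<alpha> \<equiv> cf_value ((0 # replicate m 1) \<frown> (2 # replicate (2 * k - 1) 1)\<^sup>\<omega>)"
  shows "\<forall>\<^sub>F t in at_top. t * psi \<alpha> t < fk k t"
    "\<exists>q :: nat \<Rightarrow> nat. strict_mono q \<and> (\<forall>n. q n \<ge> 2 \<and>
          ((\<lambda>t. t * psi \<alpha> t / fk k t) \<longlongrightarrow> 1) (at_left (real (q n))))"
proof -
  define j where "j = Suc m"
  define a where "a = (per_word k j)(0 := 0)"
  define X where "X = (per_quot k j)(0 := of_int 0 + 1 / per_quot k j 1)"
  interpret complete_quotients a X
    unfolding a_def X_def by (intro complete_quotients_head complete_quotients_per_word k)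
  have \<alpha>: "\<alpha> = X 0"
    unfolding \<alpha>_def beta_word[OF k m] j_def[symmetric] a_def[symmetric]
    by (rule cf_value_eq) unfold_locales
  have a: "a n = per_word k j n" if "n \<ge> 1" for n using that by (simp add: a_def)
  have root: "X n = 1 + fib_root k" if "n \<ge> 1" "a n = 2" for n
  proof -
    have "(int j - int n) mod int (2 * k) = 0"
      using that a[of n] by (simp add: per_word_def split: if_splits)
    then show ?thesis using that by (simp add: X_def per_quot_def fib_quot_0)
  qed
  have two: "a (j + 2 * k * t) = 2" and one: "0 < i \<Longrightarrow> i < 2 * k \<Longrightarrow> a (j + 2 * k * t + i) = 1" for t i
    using per_word_periodic[of 1 k j t] per_word_periodic[of i k j t] k by (auto simp: a j_def)
  have small: "a n = 1" if "0 < n" "n < j" for n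
  proof -
    have "int j - int n = int (j - n)" using that by simp
    moreover have "\<not> 2 * k dvd j - n" using that m by (intro nat_dvd_not_less) (auto simp: j_def)
    ultimately have "per_word k j n = 1" by (simp only: per_word_one_iff int_dvd_int_iff not_False_eq_True)
    then show ?thesis using that a[of n] by simp
  qed
  have form: "form_at k (j + 2 * k * t) = - fib_gap k" for t
  proof (induction t)
    case 0
    have "Q (Suc 0 + i) = int (fib (Suc i))" if "i < j" for i
      using Q_ones[of i 0] small that by simp
    \<comment> \<open>For m = 0 the second equation comes from the initial values,
      \<open>Q 0 = 0 = fib 0\<close>.\<close>
    from this[of m] this[of "m - 1"] have "Q j = int (fib (Suc m))" "Q m = int (fib m)"
      by (cases m; simp add: j_def)+
    then show ?case using start unfolding form_at_def by (simp add: j_def add.commute)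
  next
    case (Suc t)
    have "form_at k (j + 2 * k * t + 2 * k) = form_at k (j + 2 * k * t)"
      by (rule form_at_period) (use k two one in \<open>auto simp: j_def\<close>)
    then show ?case using Suc by (simp add: algebra_simps)
  qed
  have form': "form_at k n = - fib_gap k" if "n \<ge> 1" "a n = 2" for n
  proof -
    have "n \<ge> j" using small[of n] that by force
    have "int (2 * k) dvd int j - int n" using that a[of n] by (simp add: per_word_two_iff)
    then have "int (2 * k) dvd int (n - j)"
      using \<open>n \<ge> j\<close> by (simp add: of_nat_diff dvd_diff_commute)
    then obtain t where "n - j = 2 * k * t" unfolding int_dvd_int_iff by (elim dvdE)
    then show ?thesis using form[of t] \<open>n \<ge> j\<close> by (metis le_add_diff_inverse)
  qed
  have Q1: "real_of_int (Q (Suc n)) \<ge> 1" for n using Q_Suc_pos[of n] by linarith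
  have le: "1 / (1 + v n) \<le> fk k (of_int (Q (Suc n)))" if n: "n \<ge> 1" for n
  proof -
    consider "a (Suc n) = 2" | "a n = 2" | "a n = 1" "a (Suc n) = 1"
      using n a[of n] a[of "Suc n"] unfolding per_word_def by (auto split: if_splits)
    then show ?thesis
    proof cases
      case 1
      then show ?thesis using value_at_two_before_extremal[OF k 1 root[OF _ 1] form'[OF _ 1]] by simp
    next
      case 2
      obtain l where l: "n = Suc l" using n by (cases n) auto
      have "1 / (1 + v n) < Dk k"
        using value_at_two_after_extremal[OF k, of l] root[OF n 2] form'[OF n 2] 2 unfolding l by simp
      also have "\<dots> < fk k (of_int (Q (Suc n)))" by (rule fk_gt_Dk[OF k Q1])
      finally show ?thesis by simp
    next
      case 3
      obtain l where l: "n = Suc l" using n by (cases n) auto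
      \<comment> \<open>For k = 1 ones and twos alternate, so two adjacent ones do not
        occur.\<close>
      have "k \<noteq> 1"
      proof
        assume "k = 1"
        then have "odd (int j - int n)" "odd (int j - int (Suc n))"
          using 3 a[of n] a[of "Suc n"] n by (auto simp: per_word_one_iff)
        then show False by simp
      qed
      then have "1 / (1 + v n) < Dk k"
        using value_between_ones[of k l] k 3 unfolding l by simp
      also have "\<dots> < fk k (of_int (Q (Suc n)))" by (rule fk_gt_Dk[OF k Q1])
      finally show ?thesis by simp
    qed
  qed
  have "t * psi \<alpha> t < fk k t" if t: "t \<ge> max 1 (of_int (Q 2))" for t
  proof -
    have t2: "t \<ge> of_int (Q 2)" using t by simp
    obtain n where n: "n \<ge> 2" "of_int (Q n) \<le> t" "t < of_int (Q (Suc n))"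
      "t * psi (X 0) t < 1 / (1 + v n)"
      by (rule psi_bound_between[OF t2])
    have "t * psi (X 0) t < fk k (of_int (Q (Suc n)))" using n(4) le[of n] n(1) by linarith
    also have "\<dots> < fk k t" by (rule fk_strict_decreasing[OF k]) (use t n in auto)
    finally show ?thesis unfolding \<alpha> .
  qed
  then show "\<forall>\<^sub>F t in at_top. t * psi \<alpha> t < fk k t"
    unfolding eventually_at_top_linorder by blast
  \<comment> \<open>The index just before a 2. Skipping the first 2 ensures p i >= 2, as
    \<open>psi_left_limit\<close> requires.\<close>
  define p where "p i = m + 2 * k * Suc i" for i
  have p: "p i \<ge> 2" "p i < p (Suc i)" for i using k by (auto simp: p_def)
  define q where "q i = nat (Q (Suc (p i)))" for i
  have q: "real (q i) = of_int (Q (Suc (p i)))" "q i \<ge> 2" for i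
  proof -
    have "Q (Suc (p i)) \<ge> 2" using Q_ge_index[of "p i"] p(1)[of i] by linarith
    then show "real (q i) = of_int (Q (Suc (p i)))" "q i \<ge> 2" by (auto simp: q_def)
  qed
  have "strict_mono q" unfolding strict_mono_Suc_iff
  proof
    fix i
    have "Q (Suc (p i)) < Q (Suc (Suc (p i)))" using p(1)[of i] by (intro Q_less_Suc) simp
    also have "\<dots> \<le> Q (Suc (p (Suc i)))" using p(2)[of i] by (intro Q_mono) simp
    finally show "q i < q (Suc i)" using Q_nonneg[of "Suc (p i)"] by (simp add: q_def del: cf_den.simps)
  qed
  moreover have "((\<lambda>t. t * psi \<alpha> t / fk k t) \<longlongrightarrow> 1) (at_left (real (q i)))" for i
  proof -
    have e: "Suc (p i) = j + 2 * k * Suc i" by (simp add: p_def j_def)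
    have "1 / (1 + v (p i)) = fk k (real (q i))"
      unfolding q using two[of "Suc i"] form[of "Suc i"] root[of "Suc (p i)"] unfolding e[symmetric]
      by (intro value_at_two_before_extremal[OF k]) auto
    then have lim: "((\<lambda>t. t * psi \<alpha> t) \<longlongrightarrow> fk k (real (q i))) (at_left (real (q i)))"
      using psi_left_limit[OF p(1)[of i]] unfolding q \<alpha> by simp
    have q1: "real (q i) \<ge> 1" using q(2)[of i] by simp
    have "(fk k \<longlongrightarrow> fk k (real (q i))) (at_left (real (q i)))"
      using isCont_fk[OF k q1] unfolding isCont_def by (rule filterlim_mono) (auto simp: at_le)
    moreover have "fk k (real (q i)) \<noteq> 0" using fk_gt_Dk[OF k q1] Dk_pos[OF k] by simp
    ultimately have "((\<lambda>t. t * psi \<alpha> t / fk k t) \<longlongrightarrow> fk k (real (q i)) / fk k (real (q i)))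
        (at_left (real (q i)))"
      by (rule tendsto_divide[OF lim])
    then show ?thesis using \<open>fk k (real (q i)) \<noteq> 0\<close> by simp
  qed
  ultimately show "\<exists>q :: nat \<Rightarrow> nat. strict_mono q \<and> (\<forall>n. q n \<ge> 2 \<and>
          ((\<lambda>t. t * psi \<alpha> t / fk k t) \<longlongrightarrow> 1) (at_left (real (q n))))"
    using q(2) by blast
qed

lemma extremal_beta:
  assumes "k \<ge> 1" "if odd k then \<alpha> = beta k else \<alpha> = beta1 k \<or> \<alpha> = beta2 k"
  obtains m where "Suc m < 2 * k"
    "fib_form k (int (fib (Suc (Suc m)))) (int (fib (Suc m))) = - fib_gap k"
    "\<alpha> = cf_value ((0 # replicate m 1) \<frown> (2 # replicate (2 * k - 1) 1)\<^sup>\<omega>)"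
proof (cases "odd k")
  case True
  have "Suc (k - 1) = k" using assms(1) by simp
  then show ?thesis
    using that[of "k - 1"] True assms fib_form_start(1)[of k] unfolding beta_def by simp
next
  case False
  then have "k \<ge> 2" using assms(1) by (cases "k = 1") auto
  then obtain n where n: "k = Suc (Suc n)" by (metis add_2_eq_Suc le_Suc_ex)
  show ?thesis
  proof (cases "\<alpha> = beta1 k")
    case True
    then show ?thesis
      using that[of k] False \<open>k \<ge> 2\<close> fib_form_start(2)[of k] unfolding beta1_def by (simp del: fib.simps)
  next
    case False
    then have "\<alpha> = beta2 k" using assms \<open>\<not> odd k\<close> by auto
    then show ?thesis
      using that[of n] \<open>\<not> odd k\<close> fib_form_start(3)[of "Suc n"] unfolding beta2_def n by (simp del: fib.simps)
  qed
qed

section \<open>Deviation from the golden ratio\<close>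

definition igold :: real where "igold = (sqrt 5 - 1) / 2"

lemma igold_sq: "igold\<^sup>2 = 1 - igold"
  unfolding igold_def by (simp add: field_simps power2_eq_square)

lemma igold_bounds: "0.618 < igold" "igold < 0.6181"
proof -
  have "2.236 < sqrt 5" by (rule real_less_rsqrt) (simp add: power2_eq_square)
  moreover have "sqrt 5 < 2.2362" by (rule real_less_lsqrt) (auto simp: power2_eq_square)
  ultimately show "0.618 < igold" "igold < 0.6181" by (auto simp: igold_def)
qed

text \<open>The coordinate that sends the fixed points \<open>1 + \<tau>\<close> and \<open>-\<tau>\<close> of \<open>s \<mapsto> 1 + 1/s\<close>,
  with \<open>\<tau> = 1/\<phi>\<close>, to \<open>0\<close> and \<open>\<infinity>\<close>, so that this map becomes multiplication by \<open>-\<tau>\<^sup>2\<close>.\<close>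

definition gold_dev :: "real \<Rightarrow> real" where
  "gold_dev s = (s - 1 - igold) / (s + igold)"

lemma gold_dev_step:
  assumes "s > 0"
  shows "gold_dev (1 + 1 / s) = - igold\<^sup>2 * gold_dev s"
proof -
  have i: "igold > 0" using igold_bounds by simp
  have "1 / s > 0" using assms by simp
  then have n: "1 + 1 / s + igold > 0" "s + igold > 0" using assms i by linarith+
  have "gold_dev (1 + 1 / s) = (1 - igold * s) / (s + 1 + igold * s)"
    using assms n unfolding gold_dev_def by (simp add: divide_simps)
  also have "\<dots> = - igold\<^sup>2 * (s - 1 - igold) / (s + igold)"
  proof -
    have "(1 - igold * s) * (s + igold) = (- igold\<^sup>2 * (s - 1 - igold)) * (s + 1 + igold * s)"
      using igold_sq by algebra
    moreover have "s + 1 + igold * s > 0" using assms i by (simp add: add_pos_pos)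
    ultimately show ?thesis using n by (subst frac_eq_eq) auto
  qed
  finally show ?thesis by (simp add: gold_dev_def)
qed

lemma gold_dev_iterate:
  assumes "\<And>i. i < m \<Longrightarrow> z (Suc i) = 1 + 1 / z i" "z 0 > 0"
  shows "z m > 0 \<and> gold_dev (z m) = (- igold\<^sup>2) ^ m * gold_dev (z 0)"
  using assms
proof (induction m)
  case (Suc m)
  then have "z m > 0" "gold_dev (z m) = (- igold\<^sup>2) ^ m * gold_dev (z 0)" by auto
  then show ?case using Suc.prems(1)[of m] gold_dev_step[of "z m"] by (simp add: add_pos_pos)
qed simp

lemma gold_dev_pos_iff: "s > 0 \<Longrightarrow> gold_dev s > 0 \<longleftrightarrow> s > 1 + igold"
  using igold_bounds unfolding gold_dev_def by (auto simp: zero_less_divide_iff)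

text \<open>\<open>gold_dev\<close> increases from 0.28286... at 5/2 to 0.38196... at 3;
  \<open>two_bounds\<close> supplies this interval.\<close>

lemma gold_dev_bounds:
  assumes "5 / 2 \<le> s" "s \<le> 3"
  shows "0.2828 \<le> gold_dev s" "gold_dev s \<le> 0.382"
proof -
  have p: "s + igold > 0" using assms igold_bounds by simp
  have "0.2828 * (s + igold) \<le> s - 1 - igold" using assms igold_bounds by simp
  then show "0.2828 \<le> gold_dev s" unfolding gold_dev_def using p by (simp add: pos_le_divide_eq)
  have "s - 1 - igold \<le> 0.382 * (s + igold)" using assms igold_bounds by simp
  then show "gold_dev s \<le> 0.382" unfolding gold_dev_def using p by (simp add: pos_divide_le_eq)
qed

lemma fib_iterate:
  fixes z :: "nat \<Rightarrow> real"
  assumes "\<And>i. i \<le> m \<Longrightarrow> z (Suc i) = 1 + 1 / z i" "z 0 > 0"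
  shows "z (Suc m) = (real (fib (Suc (Suc m))) * z 0 + real (fib (Suc m)))
     / (real (fib (Suc m)) * z 0 + real (fib m))"
  using assms
proof (induction m)
  case 0
  then show ?case by (simp add: field_simps)
next
  case (Suc m)
  have pos: "real (fib (Suc l)) * z 0 + real (fib l) > 0" for l
    using fib_Suc_pos[of l] Suc.prems(2) by (intro add_pos_nonneg mult_pos_pos) auto
  have "z (Suc (Suc m)) = 1 + 1 / z (Suc m)" using Suc.prems(1)[of "Suc m"] by simp
  also have "z (Suc m) = (real (fib (Suc (Suc m))) * z 0 + real (fib (Suc m)))
     / (real (fib (Suc m)) * z 0 + real (fib m))"
    by (rule Suc.IH) (use Suc.prems in auto)
  also have "1 + 1 / \<dots> = (real (fib (Suc (Suc (Suc m)))) * z 0 + real (fib (Suc (Suc m))))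
     / (real (fib (Suc (Suc m))) * z 0 + real (fib (Suc m)))"
  proof -
    have "1 + 1 / (y / x) = (y + x) / y" if "y > 0" "x > 0" for x y :: real
      using that by (simp add: field_simps)
    from this[OF pos[of "Suc m"] pos[of m]] show ?thesis by (simp add: algebra_simps)
  qed
  finally show ?case .
qed

text \<open>Between blocks of \<open>2i - 1\<close> and \<open>2j - 1\<close> ones with \<open>i < j\<close>, the value of the longer block
  deviates from the golden ratio less by a factor close to \<open>\<tau>\<^sup>4\<close>.\<close>

lemma unequal_blocks:
  assumes A: "A > 0" "gold_dev A = - (p * q * g)" and B: "B > 0" "gold_dev B = - (p * h)"
    and p: "0 < p" "p \<le> igold\<^sup>2" and q: "0 < q" "q \<le> igold ^ 4"
    and g: "0 \<le> g" "g \<le> 0.382" and h: "0.2828 \<le> h" "h \<le> 0.382"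
  shows "(2 + 1 / B) * A \<ge> 2 + sqrt 5"
proof -
  define i where "i = igold"
  have i: "0.618 < i" "i < 0.6181" "i\<^sup>2 = 1 - i" using igold_bounds igold_sq by (auto simp: i_def)
  have i4: "i ^ 4 = 2 - 3 * i" using i(3) by algebra
  define e where "e = p * q * g"
  define d where "d = p * h"
  have d: "d > 0" unfolding d_def using p h by simp
  \<comment> \<open>The fourth power of \<open>igold\<close> is 0.1459..., and 0.146 times 0.382 is
    below 0.2 times 0.2828. Hence e is at most a fifth of d.\<close>
  have "q * g \<le> 0.146 * 0.382" by (rule mult_mono) (use q g i i4 in \<open>auto simp: i_def\<close>)
  also have "\<dots> \<le> 0.2 * h" using h by simp
  finally have qg: "q * g \<le> 0.2 * h" .
  have e: "0 \<le> e" "e \<le> 0.2 * d"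
    unfolding e_def d_def using mult_left_mono[OF qg, of p] p q g by (auto simp: ac_simps)
  have "d \<le> 0.382 * 0.382" unfolding d_def by (rule mult_mono) (use p h i in \<open>auto simp: i_def\<close>)
  then have e2: "e \<le> 0.03" using e by simp
  have "A - 1 - i = - e * (A + i)"
    using A igold_bounds unfolding gold_dev_def e_def i_def by (simp add: field_simps)
  then have eA: "A = 1 + i - e * (A + i)" by simp
  have "e * (A + i) \<ge> 0" using e A i by (intro mult_nonneg_nonneg) auto
  then have "A \<le> 1 + i" using eA by linarith
  \<comment> \<open>9/4 exceeds 1 + 2 i = sqrt 5, which bounds A + i.\<close>
  then have "e * (A + i) \<le> e * (9 / 4)" using e i by (intro mult_left_mono) auto
  then have A1: "A \<ge> 1 + i - 9 / 4 * e" using eA by linarith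
  then have A2: "A \<ge> 1.55" using e2 i by simp
  have "B - 1 - i = - d * (B + i)"
    using B igold_bounds unfolding gold_dev_def d_def i_def by (simp add: field_simps)
  then have "1 + d * 1 + d * (i / B) = (1 + i) / B"
    using B(1) by (simp add: field_simps)
  then have "i * (1 + d + d * (i / B)) = (i + i\<^sup>2) / B" by (simp add: algebra_simps add_divide_distrib power2_eq_square)
  then have eB: "1 / B = i * (1 + d + d * (i / B))" using i(3) by simp
  have dB: "d * (i / B) \<ge> 0" using d i B by simp
  then have "i * (1 + 0 + 0) \<le> 1 / B" unfolding eB using d i by (intro mult_left_mono) auto
  then have "i * i \<le> i * (1 / B)" using i by (intro mult_left_mono) auto
  then have "i / B \<ge> i\<^sup>2" by (simp add: power2_eq_square)
  then have "d * (i / B) \<ge> d * 0.38" using i d by (intro mult_left_mono) auto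
  then have "i * (1 + d + d * 0.38) \<le> i * (1 + d + d * (i / B))" using i by (intro mult_left_mono) auto
  then have "1 / B \<ge> i + i * (1.38 * d)" unfolding eB by (simp add: algebra_simps)
  moreover have "0.618 * (1.38 * d) \<le> i * (1.38 * d)" using i d by (intro mult_right_mono) auto
  moreover have "0.85 * d \<le> 0.618 * (1.38 * d)" using d by simp
  ultimately have B1: "1 / B \<ge> i + 0.85 * d" by (meson add_left_mono order_trans)
  have "sqrt 5 = 2 * i + 1" by (simp add: i_def igold_def field_simps)
  then have "2 + sqrt 5 = (2 + i) * (1 + i)" using i(3) by (simp add: power2_eq_square algebra_simps)
  also have "(2 + i) * (1 + i) \<le> (2 + i) * (A + 9 / 4 * e)"
    using A1 i by (intro mult_left_mono) auto
  also have "\<dots> \<le> (2 + i + 0.85 * d) * A"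
  proof -
    \<comment> \<open>The loss through A is at most 1.179 d, the gain through 1 / B at least 0.85
      times 1.55, that is 1.3175 d.\<close>
    have "(2 + i) * (9 / 4 * e) \<le> 2.6181 * (9 / 4 * (0.2 * d))"
      using i e d by (intro mult_mono) auto
    also have "\<dots> \<le> 0.85 * d * 1.55" using d by simp
    also have "\<dots> \<le> 0.85 * d * A" using A2 d by (intro mult_left_mono) auto
    finally show ?thesis by (simp add: algebra_simps)
  qed
  also have "\<dots> \<le> (2 + 1 / B) * A" using B1 A by (intro mult_right_mono) auto
  finally show ?thesis .
qed

section \<open>Sequences all of whose values are eventually large\<close>

definition fib_bound :: "nat \<Rightarrow> real" where
  "fib_bound k = real (fib (Suc (2 * k))) / real (fib (Suc (Suc (2 * k))))"

lemma fib_bound_gt_igold: "fib_bound k > igold"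
proof -
  define A B where "A = real (fib (2 * k))" and "B = real (fib (Suc (2 * k)))"
  have C: "real (fib (Suc (Suc (2 * k)))) = A + B" by (simp add: A_def B_def)
  have det: "B\<^sup>2 - A * (A + B) = 1" using real_fib_even_cassini[of k] by (simp add: A_def B_def add.commute)
  have pos: "A \<ge> 0" "B > 0" using fib_Suc_pos[of "2 * k"] by (auto simp: A_def B_def)
  have i: "igold > 0" using igold_bounds by simp
  have "(igold * (A + B))\<^sup>2 < B\<^sup>2 + B * (A + B) - igold * (A + B)\<^sup>2"
  proof -
    have "(igold * (A + B))\<^sup>2 = (A + B)\<^sup>2 - igold * (A + B)\<^sup>2" using igold_sq by algebra
    moreover have "(A + B)\<^sup>2 + 1 = B\<^sup>2 + B * (A + B)" using det by algebra
    ultimately show ?thesis by linarith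
  qed
  then have "igold * (A + B) * (igold * (A + B) + (A + B)) < B * (B + (A + B))"
    by (simp add: power2_eq_square algebra_simps)
  then have "igold * (A + B) < B"
    using pos i by (smt (verit) mult_mono mult_nonneg_nonneg)
  then show ?thesis unfolding fib_bound_def C B_def[symmetric] using pos
    by (simp add: pos_less_divide_eq add_nonneg_pos)
qed

context complete_quotients
begin

context
  fixes k N :: nat
  assumes k: "k \<ge> 1" and large: "\<And>n. n \<ge> N \<Longrightarrow> v n > fib_bound k / (2 + fib_bound k)"
begin

private abbreviation "U \<equiv> fib_bound k"

lemma U_gt: "U > igold" "U > 0.618" "U > 0"
  using fib_bound_gt_igold[of k] igold_bounds by auto

text \<open>With c the partial quotient and tails L, R, the two values of v are L/(c + R) and R/(c +
  L). The bound for the one with the smaller tail as numerator already forces that tail above cU/2.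
  For c = 2 this reads: both tails exceed U.\<close>

lemma tails_large:
  assumes "m \<ge> N"
  shows "ratio m > of_int (a (Suc m)) * U / 2" "1 / X (Suc (Suc m)) > of_int (a (Suc m)) * U / 2"
proof -
  define L R c where "L = ratio m" and "R = 1 / X (Suc (Suc m))" and "c = real_of_int (a (Suc m))"
  have c: "c \<ge> 1" using quot_ge_1[of "Suc m"] by (simp add: c_def)
  have LR: "L \<ge> 0" "R \<ge> 0" using ratio_bounds[of m] cq_gt_1[of "Suc (Suc m)"] by (auto simp: L_def R_def)
  have "v m = L / (c + R)" unfolding v_def L_def using cq_rec[of "Suc m"] by (simp add: c_def R_def)
  then have "L / (c + R) > U / (2 + U)" using large[of m] assms by simp
  then have 1: "2 * L + L * U > U * c + U * R"
    using c LR U_gt by (simp add: divide_simps add_pos_nonneg) (simp add: algebra_simps)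
  have "v (Suc m) = R / (c + L)" unfolding v_def ratio_Suc L_def R_def c_def by simp
  then have "R / (c + L) > U / (2 + U)" using large[of "Suc m"] assms by simp
  then have 2: "2 * R + R * U > U * c + U * L"
    using c LR U_gt by (simp add: divide_simps add_pos_nonneg) (simp add: algebra_simps)
  have "2 * L > c * U \<and> 2 * R > c * U"
  proof (cases "L \<le> R")
    case True
    then have "L * U \<le> R * U" using U_gt by (intro mult_right_mono) auto
    then have "2 * L > c * U" using 1 by (simp add: algebra_simps)
    then show ?thesis using True by linarith
  next
    case False
    then have "R * U \<le> L * U" using U_gt by (intro mult_right_mono) auto
    then have "2 * R > c * U" using 2 by (simp add: algebra_simps)
    then show ?thesis using False by linarith
  qed
  then show "ratio m > of_int (a (Suc m)) * U / 2" "1 / X (Suc (Suc m)) > of_int (a (Suc m)) * U / 2"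
    unfolding L_def R_def c_def by auto
qed

lemma quot_le_3: "m \<ge> N \<Longrightarrow> a (Suc m) \<le> 3"
proof (rule ccontr)
  assume m: "m \<ge> N" and "\<not> a (Suc m) \<le> 3"
  then have "real_of_int (a (Suc m)) \<ge> 4" by linarith
  then have "4 * 0.618 \<le> real_of_int (a (Suc m)) * U" using U_gt by (intro mult_mono) auto
  then show False using tails_large(1)[OF m] ratio_bounds(2)[of m] by simp
qed

text \<open>A 3 would need a left tail above 0.9. But the quotient two places earlier is at most 3
  by \<open>quot_le_3\<close>, which keeps that tail at most 4/5.\<close>

lemma quot_le_2: "m \<ge> N + 2 \<Longrightarrow> a (Suc m) \<le> 2"
proof (rule ccontr)
  assume m: "m \<ge> N + 2" and "\<not> a (Suc m) \<le> 2"
  then have "real_of_int (a (Suc m)) \<ge> 3" by linarith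
  then have "3 * 0.618 \<le> real_of_int (a (Suc m)) * U" using U_gt by (intro mult_mono) auto
  then have r: "ratio m > 0.9" using tails_large(1)[of m] m by simp
  obtain l where l: "m = Suc (Suc l)" "l \<ge> N" using m by (metis add_2_eq_Suc' le_Suc_ex add_Suc le_add1)
  have "real_of_int (a (Suc l)) \<le> 3" using quot_le_3[of l] l by linarith
  moreover have "real_of_int (a (Suc l)) \<ge> 1" using quot_ge_1[of "Suc l"] by simp
  ultimately have "ratio (Suc l) \<ge> 1 / 4" unfolding ratio_Suc using ratio_bounds[of l]
    by (simp add: divide_simps)
  moreover have "real_of_int (a m) \<ge> 1" using quot_ge_1[of m] l by simp
  ultimately have "ratio m \<le> 1 / (5 / 4)" unfolding l ratio_Suc[of "Suc l"]
    by (intro divide_left_mono) (auto simp: l)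
  then show False using r by simp
qed

lemma two_tails:
  assumes "m \<ge> N" "a (Suc m) = 2"
  shows "ratio m > U" "1 / X (Suc (Suc m)) > U"
  using tails_large[OF assms(1)] assms(2) by auto

lemma two_bounds:
  assumes "m \<ge> N" "a (Suc m) = 2"
  shows "5 / 2 \<le> X (Suc m)" "X (Suc m) \<le> 3" "5 / 2 \<le> 1 / ratio (Suc m)" "1 / ratio (Suc m) \<le> 3"
proof -
  have "1 / X (Suc (Suc m)) \<le> 1" using cq_gt_1[of "Suc (Suc m)"] by simp
  then show "5 / 2 \<le> X (Suc m)" "X (Suc m) \<le> 3"
    using cq_rec[of "Suc m"] two_tails[OF assms] U_gt assms by auto
  show "5 / 2 \<le> 1 / ratio (Suc m)" "1 / ratio (Suc m) \<le> 3"
    using ratio_bounds[of m] two_tails[OF assms] U_gt assms unfolding ratio_Suc by auto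
qed

definition two_gap :: "nat \<Rightarrow> nat \<Rightarrow> bool" where
  "two_gap n j \<longleftrightarrow> a n = 2 \<and> a (n + 2 * j) = 2 \<and> 1 \<le> j \<and> j \<le> k \<and> (\<forall>i. 0 < i \<and> i < 2 * j \<longrightarrow> a (n + i) = 1)"

lemma ones_cq_chain:
  assumes "\<And>i. 0 < i \<Longrightarrow> i < l \<Longrightarrow> a (n + i) = 1" "i < l - 1"
  shows "X (n + l - Suc i) = 1 + 1 / X (n + l - i)"
proof -
  have "a (n + (l - Suc i)) = 1" using assms by (intro assms(1)) auto
  moreover have "Suc (n + l - Suc i) = n + l - i" "n + (l - Suc i) = n + l - Suc i" using assms(2) by auto
  ultimately show ?thesis using cq_rec[of "n + l - Suc i"] by simp
qed

lemma gold_dev_after: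
  assumes "\<And>i. 0 < i \<Longrightarrow> i < l \<Longrightarrow> a (n + i) = 1" "l \<ge> 1"
  shows "gold_dev (X (Suc n)) = (- igold\<^sup>2) ^ (l - 1) * gold_dev (X (n + l))"
proof -
  have "X (n + l) > 0" using cq_gt_1[of "n + l"] assms(2) by simp
  then have "gold_dev (X (n + l - (l - 1))) = (- igold\<^sup>2) ^ (l - 1) * gold_dev (X (n + l - 0))"
    using gold_dev_iterate[of "l - 1" "\<lambda>i. X (n + l - i)"] ones_cq_chain[of l n] assms by simp
  then show ?thesis using assms(2) by simp
qed

lemma gold_dev_before:
  assumes "\<And>i. 0 < i \<Longrightarrow> i < l \<Longrightarrow> a (n + i) = 1" "l \<ge> 1" "n \<ge> 1"
  shows "gold_dev (1 / ratio (n + l - 1)) = (- igold\<^sup>2) ^ (l - 1) * gold_dev (1 / ratio n)"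
proof -
  have "ratio n > 0" using Q_Suc_pos[of "n - 1"] Q_Suc_pos[of n] assms(3) unfolding ratio_def by simp
  moreover have "1 / ratio (n + Suc i) = 1 + 1 / (1 / ratio (n + i))" if "i < l - 1" for i
    using assms(1)[of "Suc i"] that ratio_Suc[of "n + i"] by simp
  ultimately have "gold_dev (1 / ratio (n + (l - 1))) = (- igold\<^sup>2) ^ (l - 1) * gold_dev (1 / ratio (n + 0))"
    using gold_dev_iterate[of "l - 1" "\<lambda>i. 1 / ratio (n + i)"] by simp
  then show ?thesis using assms(2) by simp
qed

text \<open>Both conclusions come from the tail after the 2 exceeding U. Beginning with 2k ones
  would put it below [0; 1_(2k+1)] = U; an odd distance to the next 2 would put it below
  \<open>igold\<close> < U. Distance 1 is such a case, so twos are isolated.\<close>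

lemma next_two:
  assumes n: "n \<ge> N + 3" and two: "a n = 2"
  obtains j where "two_gap n j"
proof -
  have q12: "a i = 1 \<or> a i = 2" if i: "i \<ge> n" for i
  proof -
    obtain l where l: "i = Suc l" "l \<ge> N + 2" using i n by (cases i) auto
    show ?thesis using quot_le_2[OF l(2)] quot_ge_1[of i] l by force
  qed
  obtain m where m: "n = Suc m" "m \<ge> N" using n by (cases n) auto
  have R: "1 / X (Suc n) > U" using two_tails(2)[of m] m two by simp
  have Xn: "X (Suc n) > 0" using cq_gt_1[of "Suc n"] by simp
  have "\<exists>l. 0 < l \<and> l \<le> 2 * k \<and> a (n + l) = 2"
  proof (rule ccontr)
    assume "\<not> ?thesis"
    then have ones: "a (n + i) = 1" if "0 < i" "i < Suc (2 * k)" for i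
      using q12[of "n + i"] that by (metis le_add1 less_Suc_eq_le)
    define z where "z i = X (n + Suc (2 * k) - i)" for i
    have z0: "z 0 > 1" using cq_gt_1 by (simp add: z_def)
    define A B where "A = real (fib (2 * k))" and "B = real (fib (Suc (2 * k)))"
    obtain l where l: "2 * k = Suc l" using k by (cases "2 * k") auto
    have fl: "real (fib l) = B - A" unfolding A_def B_def l by simp
    have C: "real (fib (Suc (Suc (2 * k)))) = A + B" by (simp add: A_def B_def)
    have "z (Suc l) = (real (fib (Suc (Suc l))) * z 0 + real (fib (Suc l)))
       / (real (fib (Suc l)) * z 0 + real (fib l))"
    proof (rule fib_iterate)
      fix i assume "i \<le> l"
      then have "i < Suc (2 * k) - 1" using l by simp
      from ones_cq_chain[of "Suc (2 * k)" n, OF ones this]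
      show "z (Suc i) = 1 + 1 / z i" by (simp add: z_def)
    qed (use z0 in simp)
    then have Xz: "X (Suc n) = (B * z 0 + A) / (A * z 0 + (B - A))"
      unfolding fl[symmetric] unfolding A_def B_def l z_def by simp
    have det: "B\<^sup>2 - A * (A + B) = 1" using real_fib_even_cassini[of k] by (simp add: A_def B_def add.commute)
    have pos: "A > 0" "B > 0" "B \<ge> A" using fib_Suc_pos[of "2 * k"] fib_even_pos[OF k] fl
      by (auto simp: A_def B_def)
    have d: "A * z 0 + (B - A) > 0" using pos z0 by (intro add_pos_nonneg) auto
    have "B * (B * z 0 + A) - (A + B) * (A * z 0 + (B - A)) = z 0 - 1" using det by algebra
    then have "B * (B * z 0 + A) > (A + B) * (A * z 0 + (B - A))" using z0 by linarith
    then have "(A + B) / B < X (Suc n)" unfolding Xz using pos d by (simp add: divide_simps ac_simps)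
    then have "1 / X (Suc n) < 1 / ((A + B) / B)" using pos Xn by (intro divide_strict_left_mono mult_pos_pos divide_pos_pos) auto
    then show False using R unfolding fib_bound_def C B_def[symmetric] by simp
  qed
  then obtain l0 where l0: "0 < l0 \<and> l0 \<le> 2 * k \<and> a (n + l0) = 2" by blast
  define l where "l = (LEAST l. 0 < l \<and> l \<le> 2 * k \<and> a (n + l) = 2)"
  have l: "0 < l" "l \<le> 2 * k" "a (n + l) = 2" 
    using LeastI[of "\<lambda>l. 0 < l \<and> l \<le> 2 * k \<and> a (n + l) = 2", OF l0] unfolding l_def by auto
  have ones: "a (n + i) = 1" if "0 < i" "i < l" for i
  proof -
    have "\<not> (0 < i \<and> i \<le> 2 * k \<and> a (n + i) = 2)" using not_less_Least that(2) unfolding l_def by blast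
    then show ?thesis using q12[of "n + i"] that l by auto
  qed
  have "even l"
  proof (rule ccontr)
    assume odd: "odd l"
    have "gold_dev (X (Suc n)) = (- igold\<^sup>2) ^ (l - 1) * gold_dev (X (n + l))"
      by (rule gold_dev_after) (use ones l in auto)
    moreover have "even (l - 1)" using odd l by simp
    moreover have "gold_dev (X (n + l)) > 0"
    proof -
      have "1 / X (Suc (n + l)) > 0" using cq_gt_1[of "Suc (n + l)"] by simp
      then have "X (n + l) > 2" using cq_rec[of "n + l"] l(3) by simp
      then show ?thesis using igold_bounds by (subst gold_dev_pos_iff) auto
    qed
    moreover have "igold \<noteq> 0" using igold_bounds by auto
    ultimately have "gold_dev (X (Suc n)) > 0" by (simp add: zero_less_mult_iff)
    then have "X (Suc n) > 1 + igold" using gold_dev_pos_iff[OF Xn] by simp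
    moreover have "(1 + igold) * igold = 1" using igold_sq by (simp add: power2_eq_square algebra_simps)
    ultimately have "X (Suc n) * igold > 1" 
      using mult_strict_right_mono[of "1 + igold" "X (Suc n)" igold] igold_bounds by simp
    then have "1 / X (Suc n) < igold" using Xn by (simp add: divide_simps mult.commute)
    then show False using R U_gt(1) by simp
  qed
  then obtain j where j: "l = 2 * j" by (elim evenE)
  have "two_gap n j" unfolding two_gap_def using l ones two j by auto
  then show ?thesis using that by blast
qed

text \<open>The left side is x/(2 + x) at x = \<open>igold\<close>, and this function
  increases.\<close>

lemma inverse_sqrt5: "1 / (2 + sqrt 5) \<le> U / (2 + U)"
proof -
  have "2 + sqrt 5 = 3 + 2 * igold" by (simp add: igold_def field_simps)
  moreover have "(3 + 2 * igold) * igold = 2 + igold"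
    using igold_sq by (simp add: power2_eq_square algebra_simps)
  moreover have "(3 + 2 * igold) * U \<ge> U * 2 + U" using U_gt igold_bounds by simp
  ultimately have "2 + U \<le> U * (2 + sqrt 5)"
    using U_gt igold_bounds mult_left_mono[of igold U "1 + 2 * igold - 0"] by (simp add: algebra_simps)
  moreover have "2 + sqrt 5 > 0" by (simp add: add_pos_nonneg)
  ultimately show ?thesis using U_gt by (simp add: divide_simps ac_simps)
qed

text \<open>At the middle 2, with B the reciprocal of the left tail and A that of the right tail,
  the two adjacent values of 1/v are (2 + 1/B) A and (2 + 1/A) B. If the blocks differ,
  \<open>unequal_blocks\<close> makes one of them at least 2 + sqrt 5, so that v drops below the
  threshold.\<close>

lemma gaps_equal:
  assumes n: "n \<ge> N + 3" and gi: "two_gap n i" and gj: "two_gap (n + 2 * i) j"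
  shows "i = j"
proof -
  define n' where "n' = n + 2 * i"
  have i: "i \<ge> 1" "a n = 2" "a n' = 2" and i1: "\<And>r. 0 < r \<Longrightarrow> r < 2 * i \<Longrightarrow> a (n + r) = 1"
    using gi unfolding two_gap_def n'_def by auto
  have j: "j \<ge> 1" "a (n' + 2 * j) = 2" and j1: "\<And>r. 0 < r \<Longrightarrow> r < 2 * j \<Longrightarrow> a (n' + r) = 1"
    using gj unfolding two_gap_def n'_def by auto
  have n': "n' \<ge> N + 3" using n by (simp add: n'_def)
  define A B where "A = X (Suc n')" and "B = 1 / ratio (n' - 1)"
  define p where "p r = (igold\<^sup>2) ^ (2 * r - 1)" for r :: nat
  have sgn: "(- igold\<^sup>2) ^ (2 * r - 1) = - p r" if "r \<ge> 1" for r using that by (simp add: p_def)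
  have dA: "gold_dev A = - (p j * gold_dev (X (n' + 2 * j)))"
    using gold_dev_after[of "2 * j" n'] j1 j sgn[of j] by (simp add: A_def)
  have dB: "gold_dev B = - (p i * gold_dev (1 / ratio n))"
    using gold_dev_before[of "2 * i" n] i1 i sgn[of i] n by (simp add: B_def n'_def)
  have pos: "A > 0" using cq_gt_1[of "Suc n'"] by (simp add: A_def)
  obtain m where m: "n' = Suc m" "m \<ge> N" "m \<ge> 1" using n' by (cases n') auto
  have rm: "ratio m > U" using two_tails(1)[of m] m i by simp
  have posB: "B > 0" using rm U_gt by (simp add: B_def m)
  obtain m1 where m1: "n = Suc m1" "m1 \<ge> N" using n by (cases n) auto
  obtain m2 where m2: "n' + 2 * j = Suc m2" "m2 \<ge> N" using n' by (cases "n' + 2 * j") auto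
  have gB: "0.2828 \<le> gold_dev (1 / ratio n)" "gold_dev (1 / ratio n) \<le> 0.382"
    using gold_dev_bounds[of "1 / ratio n"] two_bounds[of m1] m1 i by auto
  have gA: "0.2828 \<le> gold_dev (X (n' + 2 * j))" "gold_dev (X (n' + 2 * j)) \<le> 0.382"
    using gold_dev_bounds[of "X (n' + 2 * j)"] two_bounds[of m2] m2 j by auto
  have i0: "0 < igold\<^sup>2" "igold\<^sup>2 \<le> 1" using igold_bounds unfolding igold_sq by auto
  have pp: "0 < p r" "p r \<le> igold\<^sup>2" if "r \<ge> 1" for r
    using i0 power_decreasing[of 1 "2 * r - 1" "igold\<^sup>2"] that by (auto simp: p_def)
  have pq: "\<exists>q. p s = p r * q \<and> 0 < q \<and> q \<le> igold ^ 4" if "1 \<le> r" "r < s" for r s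
  proof (intro exI conjI)
    have e: "2 * s - 1 = (2 * r - 1) + 2 * (s - r)" using that by simp
    show "p s = p r * (igold\<^sup>2) ^ (2 * (s - r))" unfolding p_def by (subst e) (rule power_add)
    show "(igold\<^sup>2) ^ (2 * (s - r)) \<le> igold ^ 4"
      using power_decreasing[of 2 "2 * (s - r)" "igold\<^sup>2"] i0 that by (simp flip: power_mult)
  qed (use i0 in auto)
  have V: "v n' > 1 / (2 + sqrt 5)" "v m > 1 / (2 + sqrt 5)"
    using large[of n'] large[of m] inverse_sqrt5 m n' by auto
  have vn: "v n' = 1 / ((2 + 1 / B) * A)"
    using i ratio_Suc[of m] unfolding v_def A_def B_def m by simp
  have vm: "v m = 1 / ((2 + 1 / A) * B)"
    using i cq_rec[of n'] unfolding v_def A_def B_def m by (simp add: ac_simps)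
  have s5: "2 + sqrt 5 > 0" by (simp add: add_pos_nonneg)
  have absurd: False if "(2 + 1 / y) * x \<ge> 2 + sqrt 5" "1 / ((2 + 1 / y) * x) > 1 / (2 + sqrt 5)"
    for x y :: real
    using that s5 by (smt (verit) frac_le)
  consider "i = j" | "i < j" | "j < i" by linarith
  then show ?thesis
  proof cases
    case 2
    then obtain q where q: "p j = p i * q" "0 < q" "q \<le> igold ^ 4" using pq[of i j] i by auto
    have "(2 + 1 / B) * A \<ge> 2 + sqrt 5"
      by (rule unequal_blocks[of A "p i" q "gold_dev (X (n' + 2 * j))" B "gold_dev (1 / ratio n)"])
         (use dA dB q pp[of i] i pos posB gA gB in auto)
    then show ?thesis using absurd V vn by metis
  next
    case 3
    then obtain q where q: "p i = p j * q" "0 < q" "q \<le> igold ^ 4" using pq[of j i] j by auto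
    have "(2 + 1 / A) * B \<ge> 2 + sqrt 5"
      by (rule unequal_blocks[of B "p j" q "gold_dev (1 / ratio n)" A "gold_dev (X (n' + 2 * j))"])
         (use dA dB q pp[of j] j pos posB gA gB in auto)
    then show ?thesis using absurd V vm by metis
  qed
qed

lemma eventually_periodic:
  "(\<exists>n\<ge>1. \<forall>s. a (n + s) = 1) \<or> (\<exists>n\<ge>1. \<exists>j. 1 \<le> j \<and> j \<le> k \<and> (\<forall>s. a (n + s) = (if 2 * j dvd s then 2 else 1)))"
proof (cases "\<exists>n\<ge>N + 3. a n = 2")
  case False
  have "a (N + 3 + s) = 1" for s
  proof -
    have "a (Suc (N + 2 + s)) \<le> 2" by (rule quot_le_2) simp
    moreover have "a (N + 3 + s) \<ge> 1" by (rule quot_ge_1) simp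
    moreover have "a (N + 3 + s) \<noteq> 2" using False by auto
    ultimately show ?thesis by (simp add: numeral_3_eq_3)
  qed
  then have "\<exists>n\<ge>1. \<forall>s. a (n + s) = 1" by (intro exI[of _ "N + 3"]) auto
  then show ?thesis ..
next
  case True
  then obtain n where n: "n \<ge> N + 3" "a n = 2" by blast
  obtain j where gap: "two_gap n j" using next_two[OF n] by blast
  have j: "1 \<le> j" "j \<le> k" using gap by (auto simp: two_gap_def)
  have gaps: "two_gap (n + 2 * j * t) j" for t
  proof (induction t)
    case (Suc t)
    have e: "n + 2 * j * Suc t = n + 2 * j * t + 2 * j" by simp
    have "a (n + 2 * j * Suc t) = 2" using Suc unfolding e two_gap_def by simp
    then obtain j' where j': "two_gap (n + 2 * j * Suc t) j'" using next_two[of "n + 2 * j * Suc t"] n by auto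
    then have "j = j'" using gaps_equal[OF _ Suc] n unfolding e by simp
    then show ?case using j' by simp
  qed (use gap in simp)
  have "a (n + s) = (if 2 * j dvd s then 2 else 1)" for s
  proof -
    define r where "r = s mod (2 * j)"
    have r: "r < 2 * j" using j by (simp add: r_def)
    have s: "s = 2 * j * (s div (2 * j)) + r" by (simp add: r_def)
    show ?thesis
    proof (cases "r = 0")
      case True
      then have "2 * j dvd s" unfolding r_def by (rule mod_0_imp_dvd)
      then show ?thesis using gaps[of "s div (2 * j)"] s True unfolding two_gap_def by simp
    next
      case False
      then have "\<not> 2 * j dvd s" unfolding r_def by (simp add: dvd_eq_mod_eq_0)
      moreover have "a (n + 2 * j * (s div (2 * j)) + r) = 1"
        using gaps[of "s div (2 * j)"] False r unfolding two_gap_def by blast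
      ultimately show ?thesis using s by (metis add.assoc)
    qed
  qed
  then show ?thesis using j n by (intro disjI2 exI[of _ n] conjI exI[of _ j]) auto
qed

end

end

section \<open>Equivalence with the numbers alpha_j, and the conclusion\<close>

lemma cf_equiv_alpha:
  assumes "complete_quotients a X" "j \<ge> 1" "\<And>s. a (n + s) = (if 2 * j dvd s then 2 else 1)"
  shows "cf_equiv (X 0) (alpha j)"
proof -
  have "alpha j = per_quot j (2 * j - 1) 0"
    using cf_value_eq[OF complete_quotients_per_word[OF assms(2)]] alpha_word[OF assms(2)] assms(2)
    by (simp add: alpha_def)
  then have "is_cf_of (per_word j (2 * j - 1)) (alpha j)"
    using is_cf_of_cq[OF complete_quotients_per_word[OF assms(2)]] by simp
  \<comment> \<open>The first 2 of \<open>alpha j\<close> has index 2j - 1, so the two words are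
    aligned at a 2.\<close>
  moreover have "a (n + s) = per_word j (2 * j - 1) (2 * j - 1 + s)" for s
  proof -
    have e: "int (2 * j - 1) - int (2 * j - 1 + s) = - int s" by simp
    show ?thesis
      using int_dvd_int_iff[of "2 * j" s] unfolding assms(3) per_word_def e
      by (simp add: mod_eq_0_iff_dvd)
  qed
  ultimately show ?thesis using is_cf_of_cq[OF assms(1)] unfolding cf_equiv_def by blast
qed

lemma cf_equiv_alpha_0:
  assumes "complete_quotients a X" "\<And>s. a (n + s) = 1"
  shows "cf_equiv (X 0) (alpha 0)"
proof -
  have "complete_quotients (\<lambda>_. 1) (\<lambda>_. 1 + igold)"
  proof
    have "igold > 0" using igold_bounds by simp
    then show "1 + igold = real_of_int 1 + 1 / (1 + igold)"
      using igold_sq by (simp add: field_simps power2_eq_square)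
    show "1 + igold > 1" using \<open>igold > 0\<close> by simp
  qed simp
  moreover have "([1]\<^sup>\<omega>) = (\<lambda>_. 1 :: int)" by (auto simp: iter_def)
  ultimately have "is_cf_of (\<lambda>_. 1) (alpha 0)"
    using cf_value_eq[of "\<lambda>_. 1" "\<lambda>_. 1 + igold"] is_cf_of_cq[of "\<lambda>_. 1" "\<lambda>_. 1 + igold"]
    unfolding alpha_def by simp
  then show ?thesis using is_cf_of_cq[OF assms(1)] assms(2) unfolding cf_equiv_def by blast
qed

context complete_quotients
begin

text \<open>The hypothesis excludes only j < k, so a tail with the period of alpha_k is treated
  first, by the exact formula at late twos. In the other case this period is excluded too, which
  contradicts \<open>eventually_periodic\<close>.\<close>

lemma infinitely_often_large:
  assumes k: "k \<ge> 1" and ne: "\<And>j. j \<le> k - 1 \<Longrightarrow> \<not> cf_equiv (X 0) (alpha j)"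
  shows "\<exists>n\<ge>M. fk k (of_int (Q (Suc n))) \<le> 1 / (1 + v n)"
proof (cases "\<exists>n\<ge>1. \<forall>s. a (n + s) = (if 2 * k dvd s then 2 else 1)")
  case True
  then obtain n where n: "n \<ge> 1" "\<And>s. a (n + s) = (if 2 * k dvd s then 2 else 1)" by blast
  define i where "i = n + 2 * k * Suc M"
  have "1 * Suc M \<le> 2 * k * Suc M" by (rule mult_right_mono) (use k in auto)
  then have iM: "i \<ge> Suc M" unfolding i_def by (simp only: mult_1 trans_le_add2)
  then obtain m where m: "i = Suc m" "m \<ge> M" by (cases i) auto
  have cq: "complete_quotients a X" by unfold_locales
  have "a (n + s) = per_word k 0 (0 + s)" for s
    using int_dvd_int_iff[of "2 * k" s] unfolding n(2) per_word_def by (simp add: mod_eq_0_iff_dvd)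
  from complete_quotients_unique[OF cq complete_quotients_per_word[OF k] this]
  have "X i = per_quot k 0 (0 + 2 * k * Suc M)" unfolding i_def by blast
  also have "\<dots> = 1 + fib_root k"
  proof -
    have "(int 0 - int (0 + 2 * k * Suc M)) mod int (2 * k) = 0" by (simp add: mod_eq_0_iff_dvd)
    then show ?thesis unfolding per_quot_def by (simp only: nat_0 fib_quot_0) 
  qed
  finally have "X (Suc m) = 1 + fib_root k" using m by simp
  moreover have "a (Suc m) = 2" using n(2)[of "2 * k * Suc M"] unfolding m(1)[symmetric] i_def by simp
  ultimately show ?thesis using fk_le_next_to_two[OF k, of m] m(2) le_SucI by blast
next
  case False
  define V where "V = fib_bound k / (2 + fib_bound k)"
  have U: "fib_bound k > 0" using fib_bound_gt_igold[of k] igold_bounds by simp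
  have w: "fib_bound k < fib_root k - 1" unfolding fib_bound_def by (rule fib_ratio_less_root[OF k])
  have w1: "fib_root k > 1" by (rule fib_root_gt_1[OF k])
  have V0: "V > 0" using U by (simp add: V_def)
  \<comment> \<open>With w - 1 in place of \<open>fib_bound k\<close> the right side would be D_k.
    The strict inequality between them leaves room for f_k, which tends to D_k.\<close>
  have "1 / (1 + V) = (2 + fib_bound k) / (2 + 2 * fib_bound k)"
    using U unfolding V_def by (simp add: field_simps)
  moreover have "Dk k < (2 + fib_bound k) / (2 + 2 * fib_bound k)"
    using U w w1 unfolding Dk_eq[OF k] by (simp add: divide_simps) (simp add: algebra_simps)
  ultimately have DV: "Dk k < 1 / (1 + V)" by simp
  have "\<forall>\<^sub>F x in at_top. fk k x < 1 / (1 + V)"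
    using fk_tendsto[OF k] DV by (rule order_tendstoD)
  then obtain x0 where x0: "\<And>x. x \<ge> x0 \<Longrightarrow> fk k x < 1 / (1 + V)"
    unfolding eventually_at_top_linorder by blast
  define N where "N = max M (nat \<lceil>x0\<rceil>)"
  have "\<exists>n\<ge>N. v n \<le> V"
  proof (rule ccontr)
    assume "\<not> ?thesis"
    then have large: "\<And>n. n \<ge> N \<Longrightarrow> v n > fib_bound k / (2 + fib_bound k)"
      unfolding V_def by (meson not_le)
    have cq: "complete_quotients a X" by unfold_locales
    consider n where "\<And>s. a (n + s) = 1"
      | n j where "n \<ge> 1" "1 \<le> j" "j \<le> k" "\<And>s. a (n + s) = (if 2 * j dvd s then 2 else 1)"
      using eventually_periodic[OF k large] by blast
    then show False
    proof cases
      case 1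
      then show False using cf_equiv_alpha_0[OF cq] ne[of 0] by blast
    next
      case 2
      then have "j \<noteq> k" using False by blast
      then show False using cf_equiv_alpha[OF cq 2(2,4)] ne[of j] 2 by auto
    qed
  qed
  then obtain n where n: "n \<ge> N" "v n \<le> V" by blast
  have "x0 \<le> of_int (Q (Suc n))"
  proof -
    have "x0 \<le> real n" using n(1) unfolding N_def by linarith
    also have "\<dots> \<le> of_int (Q (Suc n))" using Q_ge_index[of n] by linarith
    finally show ?thesis .
  qed
  then have "fk k (of_int (Q (Suc n))) \<le> 1 / (1 + V)" using x0 less_imp_le by blast
  also have "\<dots> \<le> 1 / (1 + v n)" using n(2) v_nonneg[of n] V0 by (intro divide_left_mono) auto
  finally show ?thesis using n(1) by (auto simp: N_def)
qed

lemma large_values_sequence: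
  assumes "k \<ge> 1" "\<And>j. j \<le> k - 1 \<Longrightarrow> \<not> cf_equiv (X 0) (alpha j)"
  shows "\<exists>q :: nat \<Rightarrow> nat. strict_mono q \<and> (\<forall>n. q n \<ge> 2 \<and>
    (\<exists>L. ((\<lambda>t. t * psi (X 0) t) \<longlongrightarrow> L) (at_left (real (q n))) \<and> L \<ge> fk k (real (q n))))"
proof -
  define S where "S = {n. n \<ge> 2 \<and> fk k (of_int (Q (Suc n))) \<le> 1 / (1 + v n)}"
  have "infinite S" unfolding infinite_nat_iff_unbounded_le
  proof
    fix M
    obtain n where "n \<ge> max M 2" "fk k (of_int (Q (Suc n))) \<le> 1 / (1 + v n)"
      using infinitely_often_large[OF assms] by blast
    then show "\<exists>n\<ge>M. n \<in> S" unfolding S_def by auto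
  qed
  define p where "p = enumerate S"
  have p: "p i \<in> S" "p i < p (Suc i)" for i
    using enumerate_in_set[OF \<open>infinite S\<close>] enumerate_step[OF \<open>infinite S\<close>] by (auto simp: p_def)
  define q where "q i = nat (Q (Suc (p i)))" for i
  have q: "real (q i) = of_int (Q (Suc (p i)))" "q i \<ge> 2" for i
  proof -
    have "Q (Suc (p i)) \<ge> 2" using Q_ge_index[of "p i"] p(1)[of i] unfolding S_def by simp
    then show "real (q i) = of_int (Q (Suc (p i)))" "q i \<ge> 2" by (auto simp: q_def)
  qed
  have "strict_mono q" unfolding strict_mono_Suc_iff
  proof
    fix i
    have "Q (Suc (p i)) < Q (Suc (Suc (p i)))" using p(1)[of i] unfolding S_def by (intro Q_less_Suc) simp
    also have "\<dots> \<le> Q (Suc (p (Suc i)))" using p(2)[of i] by (intro Q_mono) simp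
    finally show "q i < q (Suc i)" using Q_nonneg[of "Suc (p i)"] by (simp add: q_def del: cf_den.simps)
  qed
  moreover have "((\<lambda>t. t * psi (X 0) t) \<longlongrightarrow> 1 / (1 + v (p i))) (at_left (real (q i)))"
    "1 / (1 + v (p i)) \<ge> fk k (real (q i))" for i
    using psi_left_limit[of "p i"] p(1)[of i] unfolding q S_def by auto
  ultimately show ?thesis using q(2) by blast
qed

end

theorem theorem2:
  fixes k :: nat
  assumes "k \<ge> 1"
  shows
    "(\<forall>\<alpha>::real. \<alpha> \<notin> \<rat> \<and> (\<forall>j. 0 \<le> j \<and> j \<le> k - 1 \<longrightarrow> \<not> cf_equiv \<alpha> (alpha j)) \<longrightarrow>
        (\<exists>q :: nat \<Rightarrow> nat. strict_mono q \<and> (\<forall>n. q n \<ge> 2 \<and>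
          (\<exists>L. ((\<lambda>t. t * psi \<alpha> t) \<longlongrightarrow> L) (at_left (real (q n))) \<and> L \<ge> fk k (real (q n))))))
     \<and>
     (\<forall>\<alpha>::real. (if odd k then \<alpha> = beta k else \<alpha> = beta1 k \<or> \<alpha> = beta2 k) \<longrightarrow>
        (\<forall>\<^sub>F t in at_top. t * psi \<alpha> t < fk k t) \<and>
        (\<exists>q :: nat \<Rightarrow> nat. strict_mono q \<and> (\<forall>n. q n \<ge> 2 \<and>
          ((\<lambda>t. t * psi \<alpha> t / fk k t) \<longlongrightarrow> 1) (at_left (real (q n))))))"
proof (intro conjI allI impI)
  fix \<alpha> :: real
  assume \<alpha>: "\<alpha> \<notin> \<rat> \<and> (\<forall>j. 0 \<le> j \<and> j \<le> k - 1 \<longrightarrow> \<not> cf_equiv \<alpha> (alpha j))"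
  then obtain a X where cq: "complete_quotients a X" "X 0 = \<alpha>"
    using irrational_complete_quotients by blast
  show "\<exists>q :: nat \<Rightarrow> nat. strict_mono q \<and> (\<forall>n. q n \<ge> 2 \<and>
      (\<exists>L. ((\<lambda>t. t * psi \<alpha> t) \<longlongrightarrow> L) (at_left (real (q n))) \<and> L \<ge> fk k (real (q n))))"
    using complete_quotients.large_values_sequence[OF cq(1) assms] \<alpha> unfolding cq(2) by blast
next
  fix \<alpha> :: real
  assume "if odd k then \<alpha> = beta k else \<alpha> = beta1 k \<or> \<alpha> = beta2 k"
  then obtain m where m: "Suc m < 2 * k"
    "fib_form k (int (fib (Suc (Suc m)))) (int (fib (Suc m))) = - fib_gap k"
    "\<alpha> = cf_value ((0 # replicate m 1) \<frown> (2 # replicate (2 * k - 1) 1)\<^sup>\<omega>)"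
    by (rule extremal_beta[OF assms])
  show "\<forall>\<^sub>F t in at_top. t * psi \<alpha> t < fk k t"
    unfolding m(3) by (rule extremal_number(1)[OF assms m(1,2)])
  show "\<exists>q :: nat \<Rightarrow> nat. strict_mono q \<and> (\<forall>n. q n \<ge> 2 \<and>
      ((\<lambda>t. t * psi \<alpha> t / fk k t) \<longlongrightarrow> 1) (at_left (real (q n))))"
    unfolding m(3) by (rule extremal_number(2)[OF assms m(1,2)])
qed

end
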